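(* Let $0<\alpha\le 1$, $l>0$, $T>0$, and let $p\in C^1([0,l])$, $q\in C([0,l])$ with $p(x)>0$ and $q(x)\ge 0$ for all $x\in[0,l]$. Let $u_0\in\mathcal{M}_L$ and $L(u_0)\in\mathcal{M}_L$. Then the solution $$u(x,t)=\sum_{i=1}^{\infty}(u_0,X_i)\,E_{\alpha}(-\lambda_i t^{\alpha})\,X_i(x)$$ of the initial-boundary-value problem $$u(x,0)=u_0(x),\quad 0\le x\le l,\qquad u(0,t)=u(l,t)=0,\quad 0\le t\le T,$$ for the one-dimensional time-fractional diffusion equation $$(D_t^{\alpha}u)(x,t)=\frac{\partial}{\partial x}\left(p(x)\frac{\partial u}{\partial x}\right)-q(x)\,u,\quad x\in(0,l),\ t\in(0,T),$$ is a continuously differentiable function with respect to the time variable $t$ on the interval $(0,T)$. Here $X_i$, $i=1,2,\dots$, are the eigenfunctions corresponding to the eigenvalues $\lambda_i$ of the eigenvalue problem $L(X)=\lambda X$ on $(0,l)$, $X(0)=X(l)=0$.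
   Context: The operator $L$ is $L(f):=-\frac{d}{dx}\left(p(x)\frac{df}{dx}\right)+q(x)f$ on $(0,l)$. The space $\mathcal{M}_L$ consists of the functions $f\in C^1([0,l])\cap C^2((0,l))$ with $f(0)=f(l)=0$ and $L(f)\in L^2(0,l)$. The eigenvalue problem $L(X)=\lambda X$, $X(0)=X(l)=0$ has countably many eigenvalues $0<\lambda_1\le\lambda_2\le\dots$ (listed with multiplicity), with corresponding eigenfunctions $X_i\in\mathcal{M}_L$, $L(X_i)=\lambda_iX_i$, forming a complete orthonormal system in $L^2(0,l)$. The symbol $(f,g)$ denotes the standard scalar product in $L^2(0,l)$. The Mittag-Leffler function is $E_\alpha(z):=\sum_{k=0}^\infty \frac{z^k}{\Gamma(\alpha k+1)}$. The Caputo fractional derivative of order $\alpha$, $0<\alpha\le 1$, is $(D^\alpha f)(t):=(I^{1-\alpha}f')(t)$, where $(I^{\gamma}f)(t):=\frac{1}{\Gamma(\gamma)}\int_0^t(t-\tau)^{\gamma-1}f(\tau)\,d\tau$ for $0<\gamma<1$ and $I^0f:=f$. The symbol $D_t^\alpha$ denotes this derivative applied in the variable $t$ for fixed $x$. The function whose time-differentiability is asserted is the one defined by the displayed series; under the stated hypotheses it is the solution of the displayed initial-boundary-value problem. *)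

theory Defs
  imports "HOL-Analysis.Analysis"
begin

subsection \<open>Function spaces on an interval\<close>

text \<open>
  \<open>C\<^sup>1([a,b])\<close>: the derivative is one-sided at the end points.  (The library's
  \<open>C1_differentiable_on\<close> asks for two-sided derivatives, hence is used for open intervals only.)
\<close>
definition C1_closed :: "real \<Rightarrow> real \<Rightarrow> (real \<Rightarrow> real) \<Rightarrow> bool" where
  "C1_closed a b f \<longleftrightarrow>
     (\<exists>f'. (\<forall>x\<in>{a..b}. (f has_real_derivative f' x) (at x within {a..b})) \<and>
           continuous_on {a..b} f')"

definition C2_open :: "real \<Rightarrow> real \<Rightarrow> (real \<Rightarrow> real) \<Rightarrow> bool" where
  "C2_open a b f \<longleftrightarrow>
     f C1_differentiable_on {a<..<b} \<and> deriv f C1_differentiable_on {a<..<b}"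

definition L2_fun :: "real \<Rightarrow> (real \<Rightarrow> real) \<Rightarrow> bool" where
  "L2_fun l f \<longleftrightarrow>
     f \<in> borel_measurable (lebesgue_on {0<..<l}) \<and>
     integrable (lebesgue_on {0<..<l}) (\<lambda>x. (f x)\<^sup>2)"

definition L2_inner :: "real \<Rightarrow> (real \<Rightarrow> real) \<Rightarrow> (real \<Rightarrow> real) \<Rightarrow> real" where
  "L2_inner l f g = (LINT x|lebesgue_on {0<..<l}. f x * g x)"

subsection \<open>The operator L and the eigenvalue problem\<close>

text \<open>Only the values at \<open>x \<in> (0,l)\<close> are meaningful.\<close>
definition L_op :: "(real \<Rightarrow> real) \<Rightarrow> (real \<Rightarrow> real) \<Rightarrow> (real \<Rightarrow> real) \<Rightarrow> real \<Rightarrow> real" where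
  "L_op p q f x = - deriv (\<lambda>y. p y * deriv f y) x + q x * f x"

definition M_space :: "(real \<Rightarrow> real) \<Rightarrow> (real \<Rightarrow> real) \<Rightarrow> real \<Rightarrow> (real \<Rightarrow> real) set" where
  "M_space p q l =
     {f. C1_closed 0 l f \<and> C2_open 0 l f \<and> f 0 = 0 \<and> f l = 0 \<and> L2_fun l (L_op p q f)}"

text \<open>
  Since \<open>L(f)\<close> is a function on the open interval, \<open>L(f) \<in> M\<^sub>L\<close> means that it is the restriction
  of a (necessarily unique, by continuity) element of \<open>M\<^sub>L\<close> on \<open>[0,l]\<close>.
\<close>
definition L_op_in_M_space :: "(real \<Rightarrow> real) \<Rightarrow> (real \<Rightarrow> real) \<Rightarrow> real \<Rightarrow> (real \<Rightarrow> real) \<Rightarrow> bool" where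
  "L_op_in_M_space p q l f \<longleftrightarrow> (\<exists>g\<in>M_space p q l. \<forall>x\<in>{0<..<l}. g x = L_op p q f x)"

text \<open>
  Sequences are indexed from 0.  Completeness together with orthonormality implies that every
  eigenvalue occurs in the list, as often as its multiplicity.
\<close>
definition eigen_system ::
  "(real \<Rightarrow> real) \<Rightarrow> (real \<Rightarrow> real) \<Rightarrow> real \<Rightarrow> (nat \<Rightarrow> real) \<Rightarrow> (nat \<Rightarrow> real \<Rightarrow> real) \<Rightarrow> bool" where
  "eigen_system p q l lam X \<longleftrightarrow>
     0 < lam 0 \<and> incseq lam \<and>
     (\<forall>i. X i \<in> M_space p q l) \<and>
     (\<forall>i. \<forall>x\<in>{0<..<l}. L_op p q (X i) x = lam i * X i x) \<and>
     (\<forall>i j. L2_inner l (X i) (X j) = (if i = j then 1 else 0)) \<and>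
     (\<forall>f. L2_fun l f \<longrightarrow> (\<forall>i. L2_inner l f (X i) = 0) \<longrightarrow>
          (AE x in lebesgue_on {0<..<l}. f x = 0))"

subsection \<open>Mittag-Leffler function and Caputo derivative\<close>

definition mittag_leffler :: "real \<Rightarrow> real \<Rightarrow> real" where
  "mittag_leffler \<alpha> z = (\<Sum>k. z ^ k / Gamma (\<alpha> * real k + 1))"

definition frac_integral :: "real \<Rightarrow> (real \<Rightarrow> real) \<Rightarrow> real \<Rightarrow> real" where
  "frac_integral \<gamma> f t =
     (if \<gamma> = 0 then f t
      else 1 / Gamma \<gamma> * (LINT \<tau>:{0<..<t}|lebesgue. (t - \<tau>) powr (\<gamma> - 1) * f \<tau>))"

definition caputo :: "real \<Rightarrow> (real \<Rightarrow> real) \<Rightarrow> real \<Rightarrow> real" where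
  "caputo \<alpha> f t = frac_integral (1 - \<alpha>) (deriv f) t"

text \<open>
  Existence of the Caputo derivative at \<open>t\<close>; needed because \<open>deriv\<close> and the Lebesgue integral
  are total functions.
\<close>
definition caputo_exists :: "real \<Rightarrow> (real \<Rightarrow> real) \<Rightarrow> real \<Rightarrow> bool" where
  "caputo_exists \<alpha> f t \<longleftrightarrow>
     (\<forall>\<tau>\<in>{0<..t}. f field_differentiable at \<tau>) \<and>
     (\<alpha> \<noteq> 1 \<longrightarrow> set_integrable lebesgue {0<..<t} (\<lambda>\<tau>. (t - \<tau>) powr (- \<alpha>) * deriv f \<tau>))"

subsection \<open>The initial-boundary-value problem\<close>

text \<open>
  Classical solutions: continuous up to the boundary, twice continuously differentiable in \<open>x\<close>,
  and such that the Caputo derivative in \<open>t\<close> exists.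
\<close>
definition ibvp_solution ::
  "real \<Rightarrow> (real \<Rightarrow> real) \<Rightarrow> (real \<Rightarrow> real) \<Rightarrow> real \<Rightarrow> real \<Rightarrow> (real \<Rightarrow> real) \<Rightarrow>
   (real \<Rightarrow> real \<Rightarrow> real) \<Rightarrow> bool" where
  "ibvp_solution \<alpha> p q l T u0 u \<longleftrightarrow>
     continuous_on ({0..l} \<times> {0..T}) (\<lambda>(x, t). u x t) \<and>
     (\<forall>t\<in>{0<..<T}. C2_open 0 l (\<lambda>x. u x t)) \<and>
     (\<forall>x\<in>{0<..<l}. \<forall>t\<in>{0<..<T}. caputo_exists \<alpha> (\<lambda>s. u x s) t) \<and>
     (\<forall>x\<in>{0<..<l}. \<forall>t\<in>{0<..<T}.
        caputo \<alpha> (\<lambda>s. u x s) t =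
          deriv (\<lambda>y. p y * deriv (\<lambda>z. u z t) y) x - q x * u x t) \<and>
     (\<forall>x\<in>{0..l}. u x 0 = u0 x) \<and>
     (\<forall>t\<in>{0..T}. u 0 t = 0 \<and> u l t = 0)"

end

theory Submission
  imports Defs
begin

text \<open>
  The proof is Fourier's method.  Write \<open>c\<^sub>i = (u\<^sub>0, X\<^sub>i)\<close>.  Every claim about the series reduces to the
  locally uniform convergence of the series itself and of its formal derivatives, and this in turn
  rests on three facts.

  \<^item> Decay of the coefficients.  Green's identity, applied once to \<open>u\<^sub>0\<close> and once to \<open>L(u\<^sub>0)\<close>, shows
  that \<open>\<lambda>\<^sub>i\<^sup>2 c\<^sub>i\<close> is the Fourier coefficient of \<open>L(L(u\<^sub>0)) \<in> L\<^sup>2\<close>; it is square summable by Bessel's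
  inequality (\<open>M_space_coefficients_decay\<close>).

  \<^item> Sup-norm control by \<open>L\<close>.  The energy identity gives \<open>sup |f|\<^sup>2 \<le> C \<parallel>L(f)\<parallel>\<^sup>2\<close> for \<open>f\<close> with Dirichlet
  boundary values (\<open>dirichlet_solution_sup_bound\<close>).  For \<open>f = \<Sum> a\<^sub>i X\<^sub>i\<close> over a block of indices the
  right-hand side is \<open>C \<Sum> (\<lambda>\<^sub>i a\<^sub>i)\<^sup>2\<close>.  Hence \<open>\<Sum> a\<^sub>i(b) X\<^sub>i(x)\<close> converges uniformly in \<open>x\<close> and in any
  parameter \<open>b\<close> as soon as \<open>|\<lambda>\<^sub>i a\<^sub>i(b)|\<close> is dominated by a square summable sequence
  (\<open>eigen_series_uniformly_convergent\<close>).  By Rolle's theorem \<open>f'\<close> has a zero, so the flux \<open>p f'\<close> is bounded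
  by \<open>l\<close> times the sup norm of \<open>(p f')'\<close>; this gives uniform convergence of the differentiated series and
  the equation in \<open>x\<close> (\<open>eigen_series_classical\<close>).

  \<^item> Boundedness of the relaxation functions.  With \<open>E\<^sub>\<alpha>\<^sub>,\<^sub>\<beta>\<close> the two-parameter Mittag-Leffler function,
  \<open>d/dt E\<^sub>\<alpha>(-\<lambda> t\<^sup>\<alpha>) = - \<lambda> t\<^sup>\<alpha>\<^sup>-\<^sup>1 E\<^sub>\<alpha>\<^sub>,\<^sub>\<alpha>(-\<lambda> t\<^sup>\<alpha>)\<close>, and both \<open>E\<^sub>\<alpha>\<close> and \<open>E\<^sub>\<alpha>\<^sub>,\<^sub>\<alpha>\<close> are nonnegative and bounded on
  the negative half-line (\<open>mittag_leffler2_abs_le\<close>).  Positivity of \<open>v(t) = t\<^sup>\<alpha>\<^sup>-\<^sup>1 E\<^sub>\<alpha>\<^sub>,\<^sub>\<alpha>(-t\<^sup>\<alpha>)\<close> is read off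
  from the Volterra equation \<open>v = k - k * v\<close> with \<open>k(t) = t\<^sup>\<alpha>\<^sup>-\<^sup>1 / \<Gamma>(\<alpha>)\<close>: since \<open>k\<close> is
  log-convex, \<open>v\<close> cannot have a first zero (\<open>mittag_leffler2_kernel_pos\<close>).

  The time derivative of the series therefore costs one factor \<open>\<lambda>\<^sub>i\<close>, and \<open>\<lambda>\<^sub>i c\<^sub>i\<close> still decays fast
  enough for uniform convergence; the singular factor \<open>t\<^sup>\<alpha>\<^sup>-\<^sup>1\<close> is common to all terms and harmless on
  \<open>t \<ge> \<epsilon>\<close>.  For \<open>\<alpha> < 1\<close> that factor is integrable against the Caputo kernel \<open>(t - s)\<^sup>-\<^sup>\<alpha>\<close>, so dominated convergence
  turns the termwise fractional derivative into the one of the sum.  Finally, completeness of the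
  eigenfunctions identifies the sum at \<open>t = 0\<close> with \<open>u\<^sub>0\<close> almost everywhere, hence everywhere by
  continuity.
\<close>

section \<open>The two-parameter Mittag-Leffler function\<close>

definition mittag_leffler2 :: "real \<Rightarrow> real \<Rightarrow> real \<Rightarrow> real" where
  "mittag_leffler2 \<alpha> \<beta> z = (\<Sum>k. z ^ k / Gamma (\<alpha> * real k + \<beta>))"

text \<open>
  Since \<open>x + 1\<close> is the convex combination of \<open>x + \<alpha>\<close> and \<open>x + \<alpha> + 1\<close> with weights \<open>\<alpha>\<close> and
  \<open>1 - \<alpha>\<close>, log-convexity of \<open>\<Gamma>\<close> yields \<open>x \<Gamma>(x) \<le> \<Gamma>(x + \<alpha>) (x + \<alpha>)\<^sup>1\<^sup>-\<^sup>\<alpha>\<close>.  The resulting decay of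
  the quotient makes the ratio test work for the Mittag-Leffler series.
\<close>
lemma Gamma_ratio_le:
  fixes x \<alpha> :: real
  assumes "0 < \<alpha>" "\<alpha> \<le> 1" "1 \<le> x"
  shows "Gamma x / Gamma (x + \<alpha>) \<le> 2 * x powr (- \<alpha>)"
proof -
  have pos: "Gamma x > 0" "Gamma (x + \<alpha>) > 0" "Gamma (x + 1) > 0"
    using assms by (auto intro: Gamma_real_pos)
  have shift: "Gamma (x + \<alpha> + 1) = (x + \<alpha>) * Gamma (x + \<alpha>)"
    using assms by (intro Gamma_plus1) (auto elim!: nonpos_Ints_cases')
  have "(ln \<circ> Gamma) ((1 - (1 - \<alpha>)) *\<^sub>R (x + \<alpha>) + (1 - \<alpha>) *\<^sub>R (x + \<alpha> + 1))
        \<le> (1 - (1 - \<alpha>)) * (ln \<circ> Gamma) (x + \<alpha>) + (1 - \<alpha>) * (ln \<circ> Gamma) (x + \<alpha> + 1)"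
    using assms by (intro convex_onD[OF log_convex_Gamma_real]) auto
  also have "(1 - (1 - \<alpha>)) *\<^sub>R (x + \<alpha>) + (1 - \<alpha>) *\<^sub>R (x + \<alpha> + 1) = x + 1"
    by (simp add: algebra_simps)
  finally have "ln (Gamma (x + 1)) \<le> \<alpha> * ln (Gamma (x + \<alpha>)) + (1 - \<alpha>) * ln ((x + \<alpha>) * Gamma (x + \<alpha>))"
    by (simp add: shift)
  also have "\<dots> = ln (Gamma (x + \<alpha>) * (x + \<alpha>) powr (1 - \<alpha>))"
    using assms pos by (simp add: ln_mult_pos ln_powr) (simp add: algebra_simps)
  finally have "Gamma (x + 1) \<le> Gamma (x + \<alpha>) * (x + \<alpha>) powr (1 - \<alpha>)"
    using assms pos by (subst (asm) ln_le_cancel_iff) auto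
  moreover have "Gamma (x + 1) = x * Gamma x"
    using assms by (intro Gamma_plus1) (auto elim!: nonpos_Ints_cases')
  ultimately have 1: "x * Gamma x \<le> Gamma (x + \<alpha>) * (x + \<alpha>) powr (1 - \<alpha>)" by simp
  have "(x + \<alpha>) powr (1 - \<alpha>) \<le> (2 * x) powr (1 - \<alpha>)"
    using assms by (intro powr_mono2) auto
  also have "\<dots> = 2 powr (1 - \<alpha>) * x powr (1 - \<alpha>)"
    using assms by (simp add: powr_mult)
  also have "\<dots> \<le> 2 powr 1 * x powr (1 - \<alpha>)"
    using assms by (intro mult_right_mono powr_mono) auto
  also have "\<dots> = x * (2 * x powr (-\<alpha>))"
    using assms by (simp add: powr_diff powr_minus divide_simps)
  finally have "Gamma (x + \<alpha>) * (x + \<alpha>) powr (1 - \<alpha>) \<le> Gamma (x + \<alpha>) * (x * (2 * x powr (-\<alpha>)))"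
    using pos by (intro mult_left_mono) auto
  with 1 have "x * Gamma x \<le> x * (Gamma (x + \<alpha>) * (2 * x powr (-\<alpha>)))"
    by (simp only: mult.left_commute[of x])
  then have "Gamma x \<le> Gamma (x + \<alpha>) * (2 * x powr (-\<alpha>))"
    using assms by simp
  then show ?thesis using pos by (simp add: field_simps)
qed

lemma summable_mittag_leffler2:
  assumes "0 < \<alpha>" "\<alpha> \<le> 1" "0 < \<beta>"
  shows "summable (\<lambda>k. norm (z ^ k / Gamma (\<alpha> * real k + \<beta>)))"
proof -
  have "(\<lambda>k. 2 * \<bar>z\<bar> * (\<alpha> * real k + \<beta>) powr (-\<alpha>)) \<longlonglongrightarrow> 2 * \<bar>z\<bar> * 0"
    using assms
    by (intro tendsto_mult tendsto_const tendsto_neg_powr filterlim_tendsto_add_at_top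
        filterlim_tendsto_pos_mult_at_top[OF tendsto_const] filterlim_real_sequentially
        filterlim_at_top_add_at_top filterlim_at_top_mono[OF
          filterlim_tendsto_pos_mult_at_top[OF tendsto_const, of \<alpha>, OF _ filterlim_real_sequentially]])
      auto
  then have "eventually (\<lambda>k. 2 * \<bar>z\<bar> * (\<alpha> * real k + \<beta>) powr (-\<alpha>) < 1/2) sequentially"
    by (intro order_tendstoD) auto
  moreover have "eventually (\<lambda>k. \<alpha> * real k + \<beta> \<ge> 1) sequentially"
  proof -
    have "eventually (\<lambda>k. real k \<ge> 1 / \<alpha>) sequentially"
      using eventually_sequentially filterlim_real_sequentially by (simp add: filterlim_at_top)
    then show ?thesis
      by eventually_elim (use assms in \<open>auto simp: field_simps\<close>)
  qed
  ultimately have "eventually (\<lambda>k. 2 * \<bar>z\<bar> * (\<alpha> * real k + \<beta>) powr (-\<alpha>) < 1/2 \<and> \<alpha> * real k + \<beta> \<ge> 1) sequentially"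
    by eventually_elim auto
  then obtain N where N: "\<And>k. k \<ge> N \<Longrightarrow> 2 * \<bar>z\<bar> * (\<alpha> * real k + \<beta>) powr (-\<alpha>) < 1/2"
     "\<And>k. k \<ge> N \<Longrightarrow> \<alpha> * real k + \<beta> \<ge> 1"
    by (auto simp: eventually_sequentially)
  show ?thesis
  proof (rule summable_ratio_test[where c = "1/2" and N = N])
    fix k assume "k \<ge> N"
    define x where "x = \<alpha> * real k + \<beta>"
    have x: "x \<ge> 1" "2 * \<bar>z\<bar> * x powr (-\<alpha>) < 1/2" using N[OF \<open>k \<ge> N\<close>] by (auto simp: x_def)
    have pos: "Gamma x > 0" "Gamma (x + \<alpha>) > 0"
      using assms x by (auto intro: Gamma_real_pos)
    have "\<bar>z\<bar> * (Gamma x / Gamma (x + \<alpha>)) \<le> \<bar>z\<bar> * (2 * x powr (-\<alpha>))"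
      by (intro mult_left_mono Gamma_ratio_le) (use assms x in auto)
    also have "\<dots> \<le> 1/2" using x by simp
    finally have "\<bar>z\<bar> * (Gamma x / Gamma (x + \<alpha>)) * (\<bar>z\<bar>^k / Gamma x) \<le> 1/2 * (\<bar>z\<bar>^k / Gamma x)"
      using pos by (intro mult_right_mono) auto
    then have "\<bar>z\<bar> * \<bar>z\<bar>^k / Gamma (x + \<alpha>) \<le> 1/2 * (\<bar>z\<bar>^k / Gamma x)"
      using pos by simp
    moreover have "\<alpha> * real (Suc k) + \<beta> = x + \<alpha>" by (simp add: x_def algebra_simps)
    ultimately show "norm (norm (z ^ Suc k / Gamma (\<alpha> * real (Suc k) + \<beta>)))
        \<le> 1/2 * norm (norm (z ^ k / Gamma (\<alpha> * real k + \<beta>)))"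
      using pos by (simp add: power_abs abs_mult flip: x_def)
  qed simp
qed

lemma mittag_leffler2_sums:
  assumes "0 < \<alpha>" "\<alpha> \<le> 1" "0 < \<beta>"
  shows "(\<lambda>k. z ^ k / Gamma (\<alpha> * real k + \<beta>)) sums mittag_leffler2 \<alpha> \<beta> z"
  unfolding mittag_leffler2_def
  by (rule summable_sums, rule summable_norm_cancel, rule summable_mittag_leffler2[OF assms])

lemma mittag_leffler2_0 [simp]:
  assumes "0 < \<alpha>" "\<alpha> \<le> 1" "0 < \<beta>"
  shows "mittag_leffler2 \<alpha> \<beta> 0 = 1 / Gamma \<beta>"
  unfolding mittag_leffler2_def using powser_zero[of "\<lambda>k. 1 / Gamma (\<alpha> * real k + \<beta>)"] by simp

text \<open>
  Splitting off the term \<open>k = 0\<close>.  Together with the fractional integral below this is the Volterra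
  equation of the relaxation functions.
\<close>
lemma mittag_leffler2_shift:
  assumes "0 < \<alpha>" "\<alpha> \<le> 1" "0 < \<beta>"
  shows "mittag_leffler2 \<alpha> \<beta> z = 1 / Gamma \<beta> + z * mittag_leffler2 \<alpha> (\<beta> + \<alpha>) z"
proof -
  have "(\<lambda>k. z * (z ^ k / Gamma (\<alpha> * real k + (\<beta> + \<alpha>)))) sums (z * mittag_leffler2 \<alpha> (\<beta> + \<alpha>) z)"
    using assms by (intro sums_mult mittag_leffler2_sums) auto
  also have "(\<lambda>k. z * (z ^ k / Gamma (\<alpha> * real k + (\<beta> + \<alpha>)))) =
             (\<lambda>k. z ^ Suc k / Gamma (\<alpha> * real (Suc k) + \<beta>))"
    by (simp add: algebra_simps)
  finally have "(\<lambda>k. z ^ k / Gamma (\<alpha> * real k + \<beta>)) sums (z * mittag_leffler2 \<alpha> (\<beta> + \<alpha>) z + 1 / Gamma \<beta>)"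
    by (subst (asm) sums_Suc_iff) simp
  then show ?thesis
    using mittag_leffler2_sums[OF assms, of z] sums_unique2 by fastforce
qed

lemma mittag_leffler2_has_field_derivative:
  assumes "0 < \<alpha>" "\<alpha> \<le> 1" "0 < \<beta>"
  shows "(mittag_leffler2 \<alpha> \<beta> has_field_derivative
            (\<Sum>k. diffs (\<lambda>k. 1 / Gamma (\<alpha> * real k + \<beta>)) k * z ^ k)) (at z)"
proof -
  have "((\<lambda>z. \<Sum>k. 1 / Gamma (\<alpha> * real k + \<beta>) * z ^ k) has_field_derivative
            (\<Sum>k. diffs (\<lambda>k. 1 / Gamma (\<alpha> * real k + \<beta>)) k * z ^ k)) (at z)"
    using sums_summable[OF mittag_leffler2_sums[OF assms]]
    by (intro termdiffs_strong_converges_everywhere) simp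
  then show ?thesis by (simp add: mittag_leffler2_def[abs_def])
qed

lemma continuous_on_mittag_leffler2 [continuous_intros]:
  assumes "0 < \<alpha>" "\<alpha> \<le> 1" "0 < \<beta>" "continuous_on S f"
  shows "continuous_on S (\<lambda>x. mittag_leffler2 \<alpha> \<beta> (f x))"
proof -
  have "continuous_on UNIV (mittag_leffler2 \<alpha> \<beta>)"
    using mittag_leffler2_has_field_derivative[OF assms(1-3)] DERIV_isCont
    by (metis continuous_at_imp_continuous_on)
  from continuous_on_compose2[OF this assms(4)] show ?thesis by simp
qed

text \<open>
  Termwise differentiation, with \<open>\<Gamma>(\<alpha> k + \<alpha> + 1) = \<alpha> (k + 1) \<Gamma>(\<alpha> k + \<alpha>)\<close>.
\<close>
lemma mittag_leffler2_1_has_field_derivative: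
  assumes "0 < \<alpha>" "\<alpha> \<le> 1"
  shows "(mittag_leffler2 \<alpha> 1 has_field_derivative mittag_leffler2 \<alpha> \<alpha> z / \<alpha>) (at z)"
proof -
  have "diffs (\<lambda>k. 1 / Gamma (\<alpha> * real k + 1)) k * z ^ k = z ^ k / Gamma (\<alpha> * real k + \<alpha>) / \<alpha>" for k
  proof -
    have p: "\<alpha> * real k + \<alpha> > 0" using assms by (simp add: add_nonneg_pos)
    have "Gamma (\<alpha> * real (Suc k) + 1) = Gamma ((\<alpha> * real k + \<alpha>) + 1)" by (simp add: algebra_simps)
    also have "\<dots> = (\<alpha> * real k + \<alpha>) * Gamma (\<alpha> * real k + \<alpha>)"
      using p by (intro Gamma_plus1) (auto elim!: nonpos_Ints_cases')
    also have "\<dots> = \<alpha> * real (Suc k) * Gamma (\<alpha> * real k + \<alpha>)"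
      by (simp add: algebra_simps)
    finally show ?thesis using assms by (simp add: diffs_def divide_simps)
  qed
  then have "(\<Sum>k. diffs (\<lambda>k. 1 / Gamma (\<alpha> * real k + 1)) k * z ^ k) = mittag_leffler2 \<alpha> \<alpha> z / \<alpha>"
    using sums_unique[OF sums_divide[OF mittag_leffler2_sums[OF assms(1,2,1), of z], of \<alpha>]] by simp
  then show ?thesis using mittag_leffler2_has_field_derivative[OF assms zero_less_one] by metis
qed

text \<open>
  Euler's Beta integral under the substitution \<open>s \<mapsto> s / t\<close>.
\<close>
lemma has_integral_Beta_scaled:
  fixes a b t :: real
  assumes "a > 0" "b > 0" "t > 0"
  shows "((\<lambda>s. (t - s) powr (a - 1) * s powr (b - 1)) has_integral
            t powr (a + b - 1) * Beta a b) {0<..<t}"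
proof -
  have "((\<lambda>s. s powr (b - 1) * (1 - s) powr (a - 1)) has_integral Beta b a) (cbox 0 1)"
    using has_integral_Beta_real[OF assms(2,1)] by simp
  from has_integral_affinity'[OF this, of "1/t" 0] assms
  have "((\<lambda>s. (s/t) powr (b - 1) * (1 - s/t) powr (a - 1)) has_integral (Beta b a * t)) {0..t}"
    by (simp add: field_simps)
  then have "((\<lambda>s. (s/t) powr (b - 1) * (1 - s/t) powr (a - 1)) has_integral (Beta b a * t)) {0<..<t}"
    by (simp add: has_integral_Icc_iff_Ioo)
  then have "((\<lambda>s. t powr (a + b - 2) * ((s/t) powr (b - 1) * (1 - s/t) powr (a - 1)))
     has_integral (t powr (a + b - 2) * (Beta b a * t))) {0<..<t}"
    by (rule has_integral_mult_right)
  moreover have "t powr (a + b - 2) * ((s/t) powr (b - 1) * (1 - s/t) powr (a - 1)) =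
      (t - s) powr (a - 1) * s powr (b - 1)" if "s \<in> {0<..<t}" for s
  proof -
    have "1 - s/t = (t - s)/t" using assms by (simp add: field_simps)
    moreover have "t powr (a + b - 2) = t powr (b - 1) * t powr (a - 1)"
      by (simp add: algebra_simps flip: powr_add)
    ultimately show ?thesis using that by (simp add: powr_divide)
  qed
  moreover have "t powr (a + b - 2) * (Beta b a * t) = t powr (a + b - 1) * Beta a b"
  proof -
    have "t powr (a + b - 1) = t powr (a + b - 2 + 1)" by (rule arg_cong) simp
    also have "\<dots> = t powr (a + b - 2) * t" using assms by (simp only: powr_add) simp
    finally show ?thesis by (simp add: Beta_commute)
  qed
  ultimately show ?thesis by (metis (no_types, lifting) has_integral_cong)
qed

lemma Beta_integral_scaled:
  fixes a b t :: real
  assumes "a > 0" "b > 0" "t > 0"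
  shows "integrable (lebesgue_on {0<..<t}) (\<lambda>s. (t - s) powr (a - 1) * s powr (b - 1))"
    and "(LINT s|lebesgue_on {0<..<t}. (t - s) powr (a - 1) * s powr (b - 1)) =
            t powr (a + b - 1) * Beta a b"
proof -
  note hi = has_integral_Beta_scaled[OF assms]
  show 1: "integrable (lebesgue_on {0<..<t}) (\<lambda>s. (t - s) powr (a - 1) * s powr (b - 1))"
    using nonnegative_absolutely_integrable_1[OF has_integral_integrable[OF hi]]
    by (simp add: integrable_restrict_space set_integrable_def)
  show "(LINT s|lebesgue_on {0<..<t}. (t - s) powr (a - 1) * s powr (b - 1)) =
            t powr (a + b - 1) * Beta a b"
    using lebesgue_integral_eq_integral[OF 1] hi by (simp add: integral_unique)
qed

text \<open>
  Fractional integration of order \<open>\<mu>\<close> raises \<open>\<beta>\<close> by \<open>\<mu>\<close>: each power of \<open>s\<close> contributes a Beta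
  integral, and the interchange of sum and integral is justified because the integrals of the
  absolute values form the Mittag-Leffler series at \<open>\<bar>z\<bar> t\<^sup>\<alpha>\<close>.  With \<open>\<beta> = \<alpha>\<close>, the case \<open>\<mu> = \<alpha>\<close> gives the Volterra
  equation and the case \<open>\<mu> = 1 - \<alpha>\<close>, up to the factor \<open>z\<close>, the Caputo derivative of \<open>E\<^sub>\<alpha>(z t\<^sup>\<alpha>)\<close>.
\<close>
lemma mittag_leffler2_fractional_integral:
  fixes \<alpha> \<beta> \<mu> t z :: real
  assumes "0 < \<alpha>" "\<alpha> \<le> 1" "0 < \<beta>" "0 < \<mu>" "0 < t"
  defines "F \<equiv> \<lambda>s. (t - s) powr (\<mu> - 1) * (s powr (\<beta> - 1) * mittag_leffler2 \<alpha> \<beta> (z * s powr \<alpha>))"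
  shows "integrable (lebesgue_on {0<..<t}) F"
    and "(LINT s|lebesgue_on {0<..<t}. F s) =
            Gamma \<mu> * (t powr (\<beta> + \<mu> - 1) * mittag_leffler2 \<alpha> (\<beta> + \<mu>) (z * t powr \<alpha>))"
proof -
  define b where "b k = \<alpha> * real k + \<beta>" for k
  have b: "b k > 0" for k using assms by (simp add: b_def add_nonneg_pos)
  have Gpos: "Gamma (b k) > 0" "Gamma (b k + \<mu>) > 0" "Gamma \<mu> > 0" for k
    using b[of k] assms by (auto intro!: Gamma_real_pos)
  define f where "f k s = z ^ k / Gamma (b k) * ((t - s) powr (\<mu> - 1) * s powr (b k - 1))" for k s
  have int_f: "integrable (lebesgue_on {0<..<t}) (f k)" for k
    unfolding f_def using Beta_integral_scaled(1)[OF \<open>0 < \<mu>\<close> b \<open>0 < t\<close>] by simp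
  have tp: "t powr (\<mu> + b k - 1) = t powr (\<beta> + \<mu> - 1) * (t powr \<alpha>) ^ k" for k
  proof -
    have "(t powr \<alpha>) ^ k = t powr (\<alpha> * real k)"
      using assms by (simp add: powr_powr flip: powr_realpow)
    then show ?thesis by (simp add: b_def algebra_simps flip: powr_add)
  qed
  have val: "c / Gamma (b k) * (t powr (\<mu> + b k - 1) * Beta \<mu> (b k)) =
        Gamma \<mu> * t powr (\<beta> + \<mu> - 1) * (c * (t powr \<alpha>) ^ k / Gamma (\<alpha> * real k + (\<beta> + \<mu>)))" for c k
  proof -
    have "Beta \<mu> (b k) = Gamma \<mu> * Gamma (b k) / Gamma (b k + \<mu>)"
      by (simp add: Beta_def add.commute)
    then show ?thesis using Gpos(1)[of k] Gpos(2)[of k] unfolding tp by (simp add: b_def add.assoc)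
  qed
  have int1: "(LINT s|lebesgue_on {0<..<t}. f k s) =
      Gamma \<mu> * t powr (\<beta> + \<mu> - 1) * ((z * t powr \<alpha>) ^ k / Gamma (\<alpha> * real k + (\<beta> + \<mu>)))" for k
    unfolding f_def
    by (subst integral_mult_right_zero, subst Beta_integral_scaled(2)[OF \<open>0 < \<mu>\<close> b \<open>0 < t\<close>],
        subst val) (simp add: power_mult_distrib)
  have "(LINT s|lebesgue_on {0<..<t}. norm (f k s)) =
       (LINT s|lebesgue_on {0<..<t}. \<bar>z\<bar> ^ k / Gamma (b k) * ((t - s) powr (\<mu> - 1) * s powr (b k - 1)))" for k
    using Gpos(1)[of k] by (intro Bochner_Integration.integral_cong refl) (simp add: f_def abs_mult power_abs)
  then have int2: "(LINT s|lebesgue_on {0<..<t}. norm (f k s)) =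
      Gamma \<mu> * t powr (\<beta> + \<mu> - 1) * ((\<bar>z\<bar> * t powr \<alpha>) ^ k / Gamma (\<alpha> * real k + (\<beta> + \<mu>)))" for k
    by (simp only: integral_mult_right_zero Beta_integral_scaled(2)[OF \<open>0 < \<mu>\<close> b \<open>0 < t\<close>] val power_mult_distrib)
  have sums_F: "(\<lambda>k. f k s) sums F s" if "s \<in> {0<..<t}" for s
  proof -
    have "(\<lambda>k. (t - s) powr (\<mu> - 1) * (s powr (\<beta> - 1) * ((z * s powr \<alpha>) ^ k / Gamma (\<alpha> * real k + \<beta>))))
        sums F s"
      unfolding F_def by (intro sums_mult mittag_leffler2_sums) (use assms in auto)
    moreover have "(t - s) powr (\<mu> - 1) * (s powr (\<beta> - 1) * ((z * s powr \<alpha>) ^ k / Gamma (\<alpha> * real k + \<beta>))) = f k s" for k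
    proof -
      have "(s powr \<alpha>) ^ k = s powr (\<alpha> * real k)"
        using that by (simp add: powr_powr flip: powr_realpow)
      moreover have "s powr (b k - 1) = s powr (\<alpha> * real k) * s powr (\<beta> - 1)"
        by (simp add: b_def algebra_simps flip: powr_add)
      ultimately show ?thesis by (simp add: f_def b_def power_mult_distrib)
    qed
    ultimately show ?thesis by simp
  qed
  have "summable (\<lambda>k. norm (f k s))" if "s \<in> {0<..<t}" for s
  proof -
    have eq: "norm (f k s) = (t - s) powr (\<mu> - 1) * (s powr (\<beta> - 1) * norm ((z * s powr \<alpha>) ^ k / Gamma (\<alpha> * real k + \<beta>)))" for k
    proof -
      have "(s powr \<alpha>) ^ k = s powr (\<alpha> * real k)"
        using that by (simp add: powr_powr flip: powr_realpow)
      moreover have "s powr (b k - 1) = s powr (\<alpha> * real k) * s powr (\<beta> - 1)"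
        by (simp add: b_def algebra_simps flip: powr_add)
      ultimately show ?thesis by (simp add: f_def b_def power_mult_distrib abs_mult)
    qed
    show ?thesis unfolding eq
      by (intro summable_mult summable_mittag_leffler2 assms(1-3))
  qed
  then have AE: "AE s in lebesgue_on {0<..<t}. summable (\<lambda>k. norm (f k s))"
    by (intro AE_I2) simp
  have sm: "summable (\<lambda>k. LINT s|lebesgue_on {0<..<t}. norm (f k s))"
    unfolding int2 using assms
    by (intro summable_mult sums_summable[OF mittag_leffler2_sums]) auto
  have cong: "(\<Sum>k. f k s) = F s" if "s \<in> space (lebesgue_on {0<..<t})" for s
    using sums_unique[OF sums_F, of s] that by simp
  show "integrable (lebesgue_on {0<..<t}) F"
    by (rule Bochner_Integration.integrable_cong[OF refl cong, THEN iffD1, OF _ integrable_suminf[OF int_f AE sm]])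
  have "(\<lambda>k. LINT s|lebesgue_on {0<..<t}. f k s) sums (LINT s|lebesgue_on {0<..<t}. F s)"
    using sums_integral[OF int_f AE sm]
    by (subst Bochner_Integration.integral_cong[OF refl cong, symmetric])
  moreover have "(\<lambda>k. LINT s|lebesgue_on {0<..<t}. f k s) sums
     (Gamma \<mu> * t powr (\<beta> + \<mu> - 1) * mittag_leffler2 \<alpha> (\<beta> + \<mu>) (z * t powr \<alpha>))"
    unfolding int1 using assms by (intro sums_mult mittag_leffler2_sums) auto
  ultimately show "(LINT s|lebesgue_on {0<..<t}. F s) =
            Gamma \<mu> * (t powr (\<beta> + \<mu> - 1) * mittag_leffler2 \<alpha> (\<beta> + \<mu>) (z * t powr \<alpha>))"
    using sums_unique2 by (simp add: mult.assoc) blast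
qed

section \<open>Positivity and bounds on the negative half-line\<close>

text \<open>
  Suppose that \<open>v(s) = s\<^sup>\<alpha>\<^sup>-\<^sup>1 E\<^sub>\<alpha>\<^sub>,\<^sub>\<alpha>(-s\<^sup>\<alpha>)\<close>, which is positive near \<open>0\<close>, becomes nonpositive, and first
  does so at \<open>t0\<close>.  Let \<open>t1\<close> be a maximum point of \<open>v\<close> on a short interval \<open>[t0 - d, t0]\<close>.  In the Volterra
  equation \<open>\<Gamma>(\<alpha>) v(t0) = t0\<^sup>\<alpha>\<^sup>-\<^sup>1 - \<integral>\<^sub>0\<^sup>t\<^sup>0 (t0 - s)\<^sup>\<alpha>\<^sup>-\<^sup>1 v(s) ds\<close> the integral over \<open>[0, t1]\<close> is compared with
  the one in the equation at \<open>t1\<close> by means of \<open>(t0 - s)\<^sup>\<alpha>\<^sup>-\<^sup>1 \<le> (t0 / t1)\<^sup>\<alpha>\<^sup>-\<^sup>1 (t1 - s)\<^sup>\<alpha>\<^sup>-\<^sup>1\<close>, and the integral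
  over \<open>[t1, t0]\<close> is at most a small multiple of \<open>v(t1)\<close>.  The outcome is \<open>v(t0) > 0\<close>.
\<close>
lemma mittag_leffler2_kernel_pos:
  fixes \<alpha> t :: real
  assumes "0 < \<alpha>" "\<alpha> \<le> 1" "0 \<le> t"
  shows "0 < mittag_leffler2 \<alpha> \<alpha> (- (t powr \<alpha>))"
proof (rule ccontr)
  define n where "n s = mittag_leffler2 \<alpha> \<alpha> (- (s powr \<alpha>))" for s
  define v where "v s = s powr (\<alpha> - 1) * n s" for s
  assume "\<not> 0 < mittag_leffler2 \<alpha> \<alpha> (- (t powr \<alpha>))"
  then have nt: "n t \<le> 0" by (simp add: n_def)
  have Gpos: "Gamma \<alpha> > 0" using assms by (auto intro: Gamma_real_pos)
  have contn: "continuous_on {0..} n"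
    unfolding n_def using assms by (intro continuous_intros continuous_on_powr') auto
  have n0: "n 0 > 0" using assms Gpos by (simp add: n_def)
  define Z where "Z = {s\<in>{0..t}. n s \<le> 0}"
  have "compact Z"
  proof -
    have "closed ({0..t} \<inter> n -` {..0})"
      by (intro continuous_closed_preimage continuous_on_subset[OF contn]) auto
    also have "{0..t} \<inter> n -` {..0} = Z" by (auto simp: Z_def)
    finally have "closed Z" .
    moreover have "bounded Z"
      by (rule bounded_subset[OF bounded_closed_interval[of 0 t]]) (auto simp only: Z_def)
    ultimately show ?thesis by (simp add: compact_eq_bounded_closed)
  qed
  moreover have "Z \<noteq> {}" using nt assms by (auto simp: Z_def)
  ultimately obtain t0 where t0: "t0 \<in> Z" "\<And>s. s \<in> Z \<Longrightarrow> t0 \<le> s"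
    using compact_attains_inf[of Z] by blast
  have "n t0 \<le> 0" "t0 \<noteq> 0" using t0(1) n0 by (auto simp: Z_def)
  with t0(1) have t0p: "t0 > 0" "t0 \<le> t" by (auto simp: Z_def)
  have npos: "n s > 0" if "0 \<le> s" "s < t0" for s
    using t0(2)[of s] that t0p by (force simp: Z_def)
  have vpos: "v s > 0" if "0 < s" "s < t0" for s
    using npos[of s] that by (simp add: v_def)
  have vt0: "v t0 \<le> 0" using \<open>n t0 \<le> 0\<close> by (simp add: v_def mult_nonneg_nonpos)
  have contv: "continuous_on {0<..} v"
    unfolding v_def by (intro continuous_intros continuous_on_subset[OF contn]) auto

  define J where "J r = integral {0<..<r} (\<lambda>s. (r - s) powr (\<alpha> - 1) * v s)" for r
  have Jint: "(\<lambda>s. (r - s) powr (\<alpha> - 1) * v s) integrable_on {0<..<r}"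
    and volterra: "Gamma \<alpha> * v r = r powr (\<alpha> - 1) - J r" if "r > 0" for r
  proof -
    note I = mittag_leffler2_fractional_integral[OF assms(1,2,1,1) that, of "-1"]
    have int: "integrable (lebesgue_on {0<..<r}) (\<lambda>s. (r - s) powr (\<alpha> - 1) * v s)"
      using I(1) by (simp add: v_def n_def)
    show "(\<lambda>s. (r - s) powr (\<alpha> - 1) * v s) integrable_on {0<..<r}"
      using int by (simp add: integrable_on_lebesgue_on)
    have "J r = Gamma \<alpha> * (r powr (\<alpha> + \<alpha> - 1) * mittag_leffler2 \<alpha> (\<alpha> + \<alpha>) (- (r powr \<alpha>)))"
      using I(2) lebesgue_integral_eq_integral[OF int] by (simp add: J_def v_def n_def)
    moreover have "r powr (\<alpha> + \<alpha> - 1) = r powr (\<alpha> - 1) * r powr \<alpha>"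
      by (simp add: algebra_simps flip: powr_add)
    moreover have "n r = 1 / Gamma \<alpha> + (- (r powr \<alpha>)) * mittag_leffler2 \<alpha> (\<alpha> + \<alpha>) (- (r powr \<alpha>))"
      unfolding n_def by (rule mittag_leffler2_shift[OF assms(1,2,1)])
    ultimately have "Gamma \<alpha> * n r = 1 - Gamma \<alpha> * r powr \<alpha> * mittag_leffler2 \<alpha> (\<alpha> + \<alpha>) (- (r powr \<alpha>))"
      "J r = r powr (\<alpha> - 1) * (Gamma \<alpha> * r powr \<alpha> * mittag_leffler2 \<alpha> (\<alpha> + \<alpha>) (- (r powr \<alpha>)))"
      using Gpos by (simp_all add: right_diff_distrib)
    moreover have "Gamma \<alpha> * v r = r powr (\<alpha> - 1) * (Gamma \<alpha> * n r)" by (simp add: v_def)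
    ultimately show "Gamma \<alpha> * v r = r powr (\<alpha> - 1) - J r" by (simp add: right_diff_distrib)
  qed

  (* The interval is short enough that the part of the integral over [t1, t0] is at most
     Gamma \<alpha> * v t1 / 4, while d \<le> t0 / 2 keeps (t0 / t1) powr (\<alpha> - 1) from falling below 1/2. *)
  define d where "d = min (t0 / 2) ((\<alpha> * Gamma \<alpha> / 4) powr (1 / \<alpha>))"
  have d: "d > 0" "d \<le> t0 / 2" "d powr \<alpha> \<le> \<alpha> * Gamma \<alpha> / 4"
  proof -
    show "d > 0" "d \<le> t0 / 2" using t0p(1) assms(1) Gpos less_imp_neq[OF Gpos] by (simp_all add: d_def)
    then have "d powr \<alpha> \<le> ((\<alpha> * Gamma \<alpha> / 4) powr (1 / \<alpha>)) powr \<alpha>"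
      using assms by (intro powr_mono2) (auto simp: d_def)
    also have "\<dots> = \<alpha> * Gamma \<alpha> / 4" using assms Gpos by (simp add: powr_powr)
    finally show "d powr \<alpha> \<le> \<alpha> * Gamma \<alpha> / 4" .
  qed
  define a where "a = t0 - d"
  have a: "0 < a" "a < t0" using d t0p by (auto simp: a_def)
  have "\<exists>t1\<in>{a..t0}. \<forall>s\<in>{a..t0}. v s \<le> v t1"
    using a by (intro continuous_attains_sup continuous_on_subset[OF contv]) auto
  then obtain t1 where t1: "t1 \<in> {a..t0}" "\<And>s. s \<in> {a..t0} \<Longrightarrow> v s \<le> v t1" by blast
  have vt1: "v t1 > 0" using vpos[of a] t1(2)[of a] a by force
  with vt0 have "t1 \<noteq> t0" by auto
  with t1 a have t1p: "0 < t1" "t1 < t0" "a \<le> t1" by auto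

  define r where "r = (t0 / t1) powr (\<alpha> - 1)"
  have rpos: "r > 0" using t1p by (simp add: r_def)
  have rk: "r * t1 powr (\<alpha> - 1) = t0 powr (\<alpha> - 1)"
    using t1p by (simp add: r_def powr_divide)
  have "2 powr (\<alpha> - 1) \<le> r"
    unfolding r_def using t1p a d assms by (intro powr_mono2') (auto simp: a_def field_simps)
  moreover have "2 powr (-1) \<le> 2 powr (\<alpha> - 1)" using assms by (intro powr_mono) auto
  ultimately have r2: "r \<ge> 1/2" by simp

  define F where "F s = (t0 - s) powr (\<alpha> - 1) * v s" for s
  have F_int: "F integrable_on {0..t0}"
    using Jint[OF t0p(1)] integrable_on_Icc_iff_Ioo by (auto simp: F_def[abs_def])
  have J0: "J t0 = integral {0..t1} F + integral {t1..t0} F"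
    using Henstock_Kurzweil_Integration.integral_combine[OF _ _ F_int, of t1] t1p
    by (simp add: J_def F_def[abs_def] integral_open_interval_real)
  have "integral {0<..<t1} F \<le> integral {0<..<t1} (\<lambda>s. r * ((t1 - s) powr (\<alpha> - 1) * v s))"
  proof (rule integral_le)
    show "F integrable_on {0<..<t1}"
      using integrable_on_subinterval[OF F_int, of 0 t1] t1p by (simp add: integrable_on_Icc_iff_Ioo)
    show "(\<lambda>s. r * ((t1 - s) powr (\<alpha> - 1) * v s)) integrable_on {0<..<t1}"
      using Jint[OF t1p(1)] by (rule integrable_on_mult_right)
    fix s assume s: "s \<in> {0<..<t1}"
    (* The ratio of the kernels (t0 - s) powr (\<alpha> - 1) and (t1 - s) powr (\<alpha> - 1) is largest
       at s = 0, which is the log-convexity of the kernel. *)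
    have "t0 / t1 * (t1 - s) \<le> t0 - s" using s t1p by (simp add: field_simps)
    then have "(t0 - s) powr (\<alpha> - 1) \<le> (t0 / t1 * (t1 - s)) powr (\<alpha> - 1)"
      using s t1p assms by (intro powr_mono2') auto
    also have "\<dots> = r * (t1 - s) powr (\<alpha> - 1)"
      using s t1p by (simp add: r_def flip: powr_mult)
    finally show "F s \<le> r * ((t1 - s) powr (\<alpha> - 1) * v s)"
      unfolding F_def mult.assoc[symmetric]
      using vpos[of s] s t1p by (intro mult_right_mono) auto
  qed
  then have J1: "integral {0..t1} F \<le> r * J t1"
    by (simp add: J_def integral_open_interval_real)
  have prim: "((\<lambda>s. v t1 * (t0 - s) powr (\<alpha> - 1)) has_integral
      (v t1 * - ((t0 - t0) powr \<alpha> / \<alpha>) - v t1 * - ((t0 - t1) powr \<alpha> / \<alpha>))) {t1..t0}"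
  proof (rule fundamental_theorem_of_calculus_interior)
    show "continuous_on {t1..t0} (\<lambda>s. v t1 * - ((t0 - s) powr \<alpha> / \<alpha>))"
      using assms by (intro continuous_intros continuous_on_powr') auto
    fix s assume "s \<in> {t1<..<t0}"
    then show "((\<lambda>s. v t1 * - ((t0 - s) powr \<alpha> / \<alpha>)) has_vector_derivative
        v t1 * (t0 - s) powr (\<alpha> - 1)) (at s)"
      using assms
      by (auto intro!: derivative_eq_intros simp flip: has_real_derivative_iff_has_vector_derivative)
  qed (use t1p in auto)
  have "integral {t1..t0} F \<le> integral {t1..t0} (\<lambda>s. v t1 * (t0 - s) powr (\<alpha> - 1))"
  proof (rule integral_le)
    show "F integrable_on {t1..t0}"
      using integrable_on_subinterval[OF F_int, of t1 t0] t1p by simp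
    show "(\<lambda>s. v t1 * (t0 - s) powr (\<alpha> - 1)) integrable_on {t1..t0}"
      using prim by blast
    fix s assume "s \<in> {t1..t0}"
    then show "F s \<le> v t1 * (t0 - s) powr (\<alpha> - 1)"
      unfolding F_def using t1(2)[of s] t1p by (subst mult.commute) (intro mult_right_mono, auto)
  qed
  also have "\<dots> = v t1 * ((t0 - t1) powr \<alpha> / \<alpha>)"
    using integral_unique[OF prim] by simp
  also have "\<dots> \<le> v t1 * (Gamma \<alpha> / 4)"
  proof -
    have "(t0 - t1) powr \<alpha> \<le> d powr \<alpha>"
      using t1p assms by (intro powr_mono2) (auto simp: a_def)
    then have "(t0 - t1) powr \<alpha> \<le> \<alpha> * Gamma \<alpha> / 4" using d by simp
    then show ?thesis using assms vt1 by (intro mult_left_mono) (auto simp: field_simps)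
  qed
  finally have J2: "integral {t1..t0} F \<le> Gamma \<alpha> * v t1 / 4" by (simp add: mult.commute)
  have "Gamma \<alpha> * v t0 \<ge> t0 powr (\<alpha> - 1) - (r * J t1 + Gamma \<alpha> * v t1 / 4)"
    using volterra[OF t0p(1)] J0 J1 J2 by linarith
  also have "t0 powr (\<alpha> - 1) - (r * J t1 + Gamma \<alpha> * v t1 / 4) = r * (t1 powr (\<alpha> - 1) - J t1) - Gamma \<alpha> * v t1 / 4"
    by (simp add: rk algebra_simps)
  also have "\<dots> = (r - 1 / 4) * Gamma \<alpha> * v t1"
    unfolding volterra[OF t1p(1), symmetric] by (simp add: algebra_simps)
  finally have "(r - 1 / 4) * Gamma \<alpha> * v t1 \<le> 0"
    using vt0 Gpos by (meson dual_order.trans mult_nonneg_nonpos less_imp_le)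
  moreover have "(r - 1 / 4) * Gamma \<alpha> * v t1 > 0"
    using r2 Gpos vt1 by (intro mult_pos_pos) auto
  ultimately show False by simp
qed

lemma mittag_leffler2_diag_pos:
  assumes "0 < \<alpha>" "\<alpha> \<le> 1" "0 \<le> x"
  shows "0 < mittag_leffler2 \<alpha> \<alpha> (- x)"
  using mittag_leffler2_kernel_pos[OF assms(1,2), of "x powr (1 / \<alpha>)"] assms
  by (simp add: powr_powr)

text \<open>
  For \<open>\<beta> > \<alpha>\<close> the function \<open>E\<^sub>\<alpha>\<^sub>,\<^sub>\<beta>\<close> is, up to a power of \<open>t\<close>, the fractional integral of order \<open>\<beta> - \<alpha>\<close> of the
  positive function of the previous lemma.
\<close>
lemma mittag_leffler2_nonneg:
  assumes "0 < \<alpha>" "\<alpha> \<le> 1" "\<alpha> \<le> \<beta>" "0 \<le> x"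
  shows "0 \<le> mittag_leffler2 \<alpha> \<beta> (- x)"
proof (cases "\<beta> = \<alpha> \<or> x = 0")
  case True
  then show ?thesis
    using mittag_leffler2_diag_pos[of \<alpha> x] assms by (auto intro: Gamma_real_nonneg)
next
  case False
  define t where "t = x powr (1 / \<alpha>)"
  have t: "t > 0" "t powr \<alpha> = x" using False assms by (auto simp: t_def powr_powr)
  define F where "F s = (t - s) powr ((\<beta> - \<alpha>) - 1) *
      (s powr (\<alpha> - 1) * mittag_leffler2 \<alpha> \<alpha> (-1 * s powr \<alpha>))" for s
  have "0 \<le> (LINT s|lebesgue_on {0<..<t}. F s)"
    using mittag_leffler2_diag_pos[OF assms(1,2)]
    by (intro integral_nonneg_AE AE_I2) (simp add: F_def less_imp_le)
  also have "\<dots> = Gamma (\<beta> - \<alpha>) * (t powr (\<beta> - 1) * mittag_leffler2 \<alpha> \<beta> (- x))"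
    unfolding F_def using False assms
    by (subst mittag_leffler2_fractional_integral(2)) (simp_all add: t)
  finally have "0 \<le> Gamma (\<beta> - \<alpha>) * t powr (\<beta> - 1) * mittag_leffler2 \<alpha> \<beta> (- x)"
    by (simp only: mult.assoc)
  moreover have "0 < Gamma (\<beta> - \<alpha>) * t powr (\<beta> - 1)"
    using t False assms by (intro mult_pos_pos Gamma_real_pos) auto
  ultimately show ?thesis
    using mult_le_cancel_left_pos[of _ 0] by fastforce
qed

text \<open>
  In \<open>E\<^sub>\<alpha>\<^sub>,\<^sub>\<beta>(-x) = 1 / \<Gamma>(\<beta>) - x E\<^sub>\<alpha>\<^sub>,\<^sub>\<beta>\<^sub>+\<^sub>\<alpha>(-x)\<close> the subtracted term is nonnegative.
\<close>
lemma mittag_leffler2_le: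
  assumes "0 < \<alpha>" "\<alpha> \<le> 1" "\<alpha> \<le> \<beta>" "0 \<le> x"
  shows "mittag_leffler2 \<alpha> \<beta> (- x) \<le> 1 / Gamma \<beta>"
  using mittag_leffler2_shift[of \<alpha> \<beta> "- x"] mittag_leffler2_nonneg[of \<alpha> "\<beta> + \<alpha>" x] assms by simp

lemma mittag_leffler2_abs_le:
  assumes "0 < \<alpha>" "\<alpha> \<le> 1" "\<alpha> \<le> \<beta>" "0 \<le> x"
  shows "\<bar>mittag_leffler2 \<alpha> \<beta> (- x)\<bar> \<le> 1 / Gamma \<beta>"
  using mittag_leffler2_nonneg[OF assms] mittag_leffler2_le[OF assms] by simp

section \<open>Sturm-Liouville problems with Dirichlet conditions\<close>

text \<open>
  The function \<open>f\<close> with derivative \<open>f'\<close> solves \<open>L(f) = g\<close> on \<open>(0,l)\<close> with zero boundary values.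
  Carrying \<open>f'\<close> along as a function on the closed interval avoids \<open>deriv\<close>, which is additive
  only where the derivatives exist and is two-sided at the end points, and lets the equation be
  written as \<open>(p f')' = q f - g\<close>.
\<close>
definition dirichlet_solution ::
  "(real \<Rightarrow> real) \<Rightarrow> (real \<Rightarrow> real) \<Rightarrow> real \<Rightarrow> (real \<Rightarrow> real) \<Rightarrow> (real \<Rightarrow> real) \<Rightarrow> (real \<Rightarrow> real) \<Rightarrow> bool" where
  "dirichlet_solution p q l f f' g \<longleftrightarrow>
     continuous_on {0..l} f' \<and>
     (\<forall>x\<in>{0..l}. (f has_real_derivative f' x) (at x within {0..l})) \<and>
     (\<forall>x\<in>{0<..<l}. ((\<lambda>y. p y * f' y) has_real_derivative q x * f x - g x) (at x)) \<and>
     f 0 = 0 \<and> f l = 0"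

lemma C1_closed_imp_continuous_on: "C1_closed a b f \<Longrightarrow> continuous_on {a..b} f"
  unfolding C1_closed_def using DERIV_continuous_on by blast

lemma dirichlet_solutionD:
  assumes "dirichlet_solution p q l f f' g"
  shows "continuous_on {0..l} f'" "continuous_on {0..l} f"
    "\<And>x. x \<in> {0..l} \<Longrightarrow> (f has_real_derivative f' x) (at x within {0..l})"
    "\<And>x. x \<in> {0<..<l} \<Longrightarrow> (f has_real_derivative f' x) (at x)"
    "\<And>x. x \<in> {0<..<l} \<Longrightarrow> ((\<lambda>y. p y * f' y) has_real_derivative q x * f x - g x) (at x)"
    "f 0 = 0" "f l = 0"
proof -
  show D: "(f has_real_derivative f' x) (at x within {0..l})" if "x \<in> {0..l}" for x
    using assms that by (simp add: dirichlet_solution_def)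
  show "(f has_real_derivative f' x) (at x)" if "x \<in> {0<..<l}" for x
    using D[of x] that by (simp add: at_within_Icc_at)
  show "continuous_on {0..l} f" using D by (rule DERIV_continuous_on)
qed (use assms in \<open>auto simp: dirichlet_solution_def\<close>)

lemma dirichlet_solution_sum:
  assumes "\<And>i. i \<in> F \<Longrightarrow> dirichlet_solution p q l (f i) (f' i) (g i)"
  shows "dirichlet_solution p q l (\<lambda>x. \<Sum>i\<in>F. c i * f i x) (\<lambda>x. \<Sum>i\<in>F. c i * f' i x) (\<lambda>x. \<Sum>i\<in>F. c i * g i x)"
  unfolding dirichlet_solution_def
proof (intro conjI ballI)
  show "continuous_on {0..l} (\<lambda>x. \<Sum>i\<in>F. c i * f' i x)"
    using assms by (intro continuous_intros) (auto dest: dirichlet_solutionD)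
  show "((\<lambda>x. \<Sum>i\<in>F. c i * f i x) has_real_derivative (\<Sum>i\<in>F. c i * f' i x)) (at x within {0..l})"
    if "x \<in> {0..l}" for x
    by (intro DERIV_sum DERIV_cmult dirichlet_solutionD(3)[OF assms] that)
  show "((\<lambda>y. p y * (\<Sum>i\<in>F. c i * f' i y)) has_real_derivative
      q x * (\<Sum>i\<in>F. c i * f i x) - (\<Sum>i\<in>F. c i * g i x)) (at x)" if "x \<in> {0<..<l}" for x
  proof -
    have "((\<lambda>y. \<Sum>i\<in>F. c i * (p y * f' i y)) has_real_derivative (\<Sum>i\<in>F. c i * (q x * f i x - g i x))) (at x)"
      by (intro DERIV_sum DERIV_cmult dirichlet_solutionD(5)[OF assms] that)
    then show ?thesis
      by (simp add: sum_distrib_left sum_subtractf algebra_simps)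
  qed
qed (use dirichlet_solutionD(6,7)[OF assms] in auto)

lemma M_space_dirichlet_solution:
  assumes p: "C1_closed 0 l p" and f: "f \<in> M_space p q l"
    and g: "\<And>x. x \<in> {0<..<l} \<Longrightarrow> g x = L_op p q f x"
  shows "\<exists>f'. dirichlet_solution p q l f f' g"
proof -
  from f obtain f' where f': "\<And>x. x \<in> {0..l} \<Longrightarrow> (f has_real_derivative f' x) (at x within {0..l})"
    "continuous_on {0..l} f'" unfolding M_space_def C1_closed_def by blast
  from f have bc: "f 0 = 0" "f l = 0" and C2: "C2_open 0 l f"
    by (auto simp: M_space_def)
  from p obtain p' where p': "\<And>x. x \<in> {0..l} \<Longrightarrow> (p has_real_derivative p' x) (at x within {0..l})"
    unfolding C1_closed_def by blast
  have df: "deriv f x = f' x" if "x \<in> {0<..<l}" for x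
    using f'(1)[of x] that by (intro DERIV_imp_deriv) (simp add: at_within_Icc_at)
  have "((\<lambda>y. p y * f' y) has_real_derivative q x * f x - g x) (at x)" if x: "x \<in> {0<..<l}" for x
  proof -
    from C2 x obtain d where "(deriv f has_real_derivative d) (at x)"
      unfolding C2_open_def C1_differentiable_on_def has_real_derivative_iff_has_vector_derivative by blast
    moreover have "(p has_real_derivative p' x) (at x)"
      using p'[of x] x by (simp add: at_within_Icc_at)
    ultimately have D: "((\<lambda>y. p y * deriv f y) has_real_derivative p' x * deriv f x + d * p x) (at x)"
      by (rule DERIV_mult[rotated])
    then have "((\<lambda>y. p y * deriv f y) has_real_derivative q x * f x - g x) (at x)"
      using DERIV_imp_deriv[OF D] g[OF x] by (simp add: L_op_def)
    then show ?thesis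
      by (rule has_field_derivative_transform_within_open[where S = "{0<..<l}"]) (use x df in auto)
  qed
  then have "dirichlet_solution p q l f f' g"
    using f' bc by (simp add: dirichlet_solution_def)
  then show ?thesis by blast
qed

text \<open>
  By Rolle's theorem \<open>f'\<close> vanishes at some point of \<open>(0,l)\<close>; from there the flux \<open>p f'\<close> is controlled by its
  derivative \<open>q f - g\<close> through the mean value theorem.
\<close>
lemma dirichlet_solution_flux_bound:
  assumes l: "0 < l" and contp: "continuous_on {0..l} p" and f: "dirichlet_solution p q l f f' g"
    and K: "\<And>x. x \<in> {0<..<l} \<Longrightarrow> \<bar>q x * f x - g x\<bar> \<le> K" and x: "x \<in> {0..l}"
  shows "\<bar>p x * f' x\<bar> \<le> l * K"
proof -
  note D = dirichlet_solutionD[OF f]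
  have "\<exists>z. 0 < z \<and> z < l \<and> (\<lambda>h. f' z * h) = (\<lambda>v. 0)"
    using D l by (intro Rolle_deriv[of 0 l f]) (auto simp: has_field_derivative_def)
  then obtain z where z: "z \<in> {0<..<l}" "f' z = 0"
    by (metis greaterThanLessThan_iff mult.right_neutral)
  define P where "P y = p y * f' y" for y
  have contP: "continuous_on {0..l} P"
    unfolding P_def by (intro continuous_intros contp D)
  have K0: "K \<ge> 0" using K[OF z(1)] by linarith
  have "\<bar>P b - P a\<bar> \<le> l * K" if "a \<le> b" "0 \<le> a" "b \<le> l" for a b
  proof (cases "a = b")
    case False
    then have "a < b" using that by simp
    have "\<exists>l z. a < z \<and> z < b \<and> DERIV P z :> l \<and> P b - P a = (b - a) * l"
    proof (rule MVT[OF \<open>a < b\<close>])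
      show "continuous_on {a..b} P" by (rule continuous_on_subset[OF contP]) (use that in auto)
      fix y assume "a < y" "y < b"
      then have "DERIV P y :> q y * f y - g y"
        using D(5)[of y] that unfolding P_def by auto
      then show "P differentiable (at y)"
        by (auto simp: real_differentiable_def)
    qed
    then obtain d y where y: "a < y" "y < b" "DERIV P y :> d" "P b - P a = (b - a) * d" by blast
    have "d = q y * f y - g y"
      using y(3) D(5)[of y] y that unfolding P_def by (intro DERIV_unique) auto
    then have "\<bar>d\<bar> \<le> K" using K[of y] y that by auto
    then show ?thesis
      unfolding y(4) abs_mult using that K0 by (intro mult_mono) auto
  qed (use K0 l in auto)
  from this[of x z] this[of z x] show ?thesis
    using x z linear[of x z] by (auto simp: P_def abs_minus_commute)
qed

text \<open>
  Sobolev inequality in dimension one.  The Cauchy-Schwarz inequality for \<open>f(x) = \<integral> f'\<close> takes the form of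
  integrating \<open>(f' - c)\<^sup>2 \<ge> 0\<close> over \<open>[0,x]\<close>, where \<open>c = f(x) / x\<close> is the mean of \<open>f'\<close>.
\<close>
lemma integral_square_deriv_bound:
  fixes f f' :: "real \<Rightarrow> real"
  assumes l: "0 < l" and cont: "continuous_on {0..l} f'"
    and D: "\<And>x. x \<in> {0..l} \<Longrightarrow> (f has_real_derivative f' x) (at x within {0..l})"
    and "f 0 = 0" and x: "x \<in> {0..l}"
  shows "(f x)\<^sup>2 \<le> l * integral {0..l} (\<lambda>y. (f' y)\<^sup>2)"
proof (cases "x = 0")
  case True
  have "0 \<le> integral {0..l} (\<lambda>y. (f' y)\<^sup>2)"
    by (intro Henstock_Kurzweil_Integration.integral_nonneg integrable_continuous_interval continuous_intros cont) auto
  then show ?thesis using True l \<open>f 0 = 0\<close> by simp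
next
  case False
  with x have xp: "x > 0" "x \<le> l" by auto
  have cx: "continuous_on {0..x} f'" using cont by (rule continuous_on_subset) (use xp in auto)
  have 1: "(f' has_integral (f x - f 0)) {0..x}"
  proof (rule fundamental_theorem_of_calculus)
    fix y assume "y \<in> {0..x}"
    then have "(f has_real_derivative f' y) (at y within {0..x})"
      using D[of y] xp by (auto intro: has_field_derivative_subset)
    then show "(f has_vector_derivative f' y) (at y within {0..x})"
      by (simp add: has_real_derivative_iff_has_vector_derivative)
  qed (use xp in auto)
  have 2: "((\<lambda>y. (f' y)\<^sup>2) has_integral integral {0..x} (\<lambda>y. (f' y)\<^sup>2)) {0..x}"
    by (intro integrable_integral integrable_continuous_interval continuous_intros cx)
  define c where "c = f x / x"
  have "((\<lambda>y. (f' y)\<^sup>2 - 2 * c * f' y + c\<^sup>2) has_integral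
     (integral {0..x} (\<lambda>y. (f' y)\<^sup>2) - 2 * c * (f x - f 0) + (x - 0) *\<^sub>R c\<^sup>2)) {0..x}"
    using xp by (intro has_integral_add has_integral_diff has_integral_mult_right 1 2)
      (use has_integral_const_real[of "c\<^sup>2" 0 x] in simp)
  then have "0 \<le> integral {0..x} (\<lambda>y. (f' y)\<^sup>2) - 2 * c * (f x - f 0) + (x - 0) *\<^sub>R c\<^sup>2"
  proof (rule has_integral_nonneg)
    fix y
    have "(f' y)\<^sup>2 - 2 * c * f' y + c\<^sup>2 = (f' y - c)\<^sup>2" by (simp add: power2_diff)
    then show "0 \<le> (f' y)\<^sup>2 - 2 * c * f' y + c\<^sup>2" by simp
  qed
  also have "\<dots> = integral {0..x} (\<lambda>y. (f' y)\<^sup>2) - (f x)\<^sup>2 / x"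
    using xp \<open>f 0 = 0\<close> by (simp add: c_def power2_eq_square field_simps)
  finally have "(f x)\<^sup>2 \<le> x * integral {0..x} (\<lambda>y. (f' y)\<^sup>2)"
    using xp by (simp add: field_simps)
  also have "\<dots> \<le> l * integral {0..l} (\<lambda>y. (f' y)\<^sup>2)"
  proof (rule mult_mono)
    show "integral {0..x} (\<lambda>y. (f' y)\<^sup>2) \<le> integral {0..l} (\<lambda>y. (f' y)\<^sup>2)"
      by (intro integral_subset_le integrable_continuous_interval continuous_intros cont cx) (use xp in auto)
    show "0 \<le> integral {0..x} (\<lambda>y. (f' y)\<^sup>2)"
      by (intro Henstock_Kurzweil_Integration.integral_nonneg integrable_continuous_interval continuous_intros cx) auto
  qed (use xp l in auto)
  finally show ?thesis .
qed

text \<open>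
  Testing the equation with \<open>f\<close> gives \<open>\<integral> (p f'\<^sup>2 + q f\<^sup>2) = \<integral> g f\<close>.  The right-hand side is estimated by
  Young's inequality and the bound \<open>f\<^sup>2 \<le> l E\<close> by the Dirichlet energy \<open>E = \<integral> f'\<^sup>2\<close>, which leaves \<open>E \<le> (l / pm)\<^sup>2 \<integral> g\<^sup>2\<close>.
\<close>
lemma dirichlet_solution_sup_bound:
  assumes l: "0 < l" and contp: "continuous_on {0..l} p" and q: "continuous_on {0..l} q"
    and pm: "0 < pm" "\<And>x. x \<in> {0..l} \<Longrightarrow> pm \<le> p x" and qn: "\<And>x. x \<in> {0..l} \<Longrightarrow> 0 \<le> q x"
    and f: "dirichlet_solution p q l f f' g" and g: "continuous_on {0..l} g" and x: "x \<in> {0..l}"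
  shows "(f x)\<^sup>2 \<le> l^3 / pm\<^sup>2 * integral {0..l} (\<lambda>y. (g y)\<^sup>2)"
proof -
  note D = dirichlet_solutionD[OF f]
  note ci = integrable_continuous_interval continuous_intros D(1,2) contp q g
  define E where "E = integral {0..l} (\<lambda>y. (f' y)\<^sup>2)"
  define G where "G = integral {0..l} (\<lambda>y. (g y)\<^sup>2)"
  have point: "(f y)\<^sup>2 \<le> l * E" if "y \<in> {0..l}" for y
    unfolding E_def by (rule integral_square_deriv_bound[OF l D(1,3,6) that])
  have "((\<lambda>y. (q y * f y - g y) * f y + f' y * (p y * f' y)) has_integral
      (p l * f' l * f l - p 0 * f' 0 * f 0)) {0..l}"
  proof (rule fundamental_theorem_of_calculus_interior)
    show "continuous_on {0..l} (\<lambda>y. p y * f' y * f y)" by (intro ci)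
    fix y assume "y \<in> {0<..<l}"
    from DERIV_mult[OF D(5)[OF this] D(4)[OF this]]
    show "((\<lambda>y. p y * f' y * f y) has_vector_derivative
        (q y * f y - g y) * f y + f' y * (p y * f' y)) (at y)"
      by (simp add: has_real_derivative_iff_has_vector_derivative)
  qed (use l in auto)
  then have i0: "integral {0..l} (\<lambda>y. (q y * f y - g y) * f y + f' y * (p y * f' y)) = 0"
    using D(6,7) by (simp add: integral_unique)
  define s where "s = pm / l\<^sup>2"
  have s: "s > 0" using pm l by (simp add: s_def)
  (* Young's inequality g f <= g^2 / (2 s) + s f^2 / 2, with s chosen so that the second term
     is absorbed by half of the Dirichlet energy. *)
  have "pm * E - (1 / (2 * s) * G + s / 2 * (l * (l * E))) =
        integral {0..l} (\<lambda>y. pm * (f' y)\<^sup>2 - (1 / (2 * s) * (g y)\<^sup>2 + s / 2 * (l * E)))"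
  proof -
    have "integral {0..l} (\<lambda>y. pm * (f' y)\<^sup>2 - (1 / (2 * s) * (g y)\<^sup>2 + s / 2 * (l * E))) =
      integral {0..l} (\<lambda>y. pm * (f' y)\<^sup>2) - integral {0..l} (\<lambda>y. 1 / (2 * s) * (g y)\<^sup>2 + s / 2 * (l * E))"
      by (intro Henstock_Kurzweil_Integration.integral_diff ci)
    also have "integral {0..l} (\<lambda>y. 1 / (2 * s) * (g y)\<^sup>2 + s / 2 * (l * E)) =
       integral {0..l} (\<lambda>y. 1 / (2 * s) * (g y)\<^sup>2) + integral {0..l} (\<lambda>y. s / 2 * (l * E))"
      by (intro Henstock_Kurzweil_Integration.integral_add ci)
    finally show ?thesis using l by (simp add: E_def G_def algebra_simps)
  qed
  also have "\<dots> \<le> integral {0..l} (\<lambda>y. (q y * f y - g y) * f y + f' y * (p y * f' y))"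
  proof (rule integral_le)
    fix y assume y: "y \<in> {0..l}"
    have "2 * s * (g y * f y) \<le> (g y)\<^sup>2 + s\<^sup>2 * (f y)\<^sup>2"
      using zero_le_power2[of "g y - s * f y"] by (simp add: power2_diff power_mult_distrib algebra_simps)
    then have "g y * f y \<le> 1 / (2 * s) * (g y)\<^sup>2 + s / 2 * (f y)\<^sup>2"
      using s by (simp add: field_simps power2_eq_square)
    also have "\<dots> \<le> 1 / (2 * s) * (g y)\<^sup>2 + s / 2 * (l * E)"
      using point[OF y] s by (intro add_left_mono mult_left_mono) auto
    finally have a: "g y * f y \<le> 1 / (2 * s) * (g y)\<^sup>2 + s / 2 * (l * E)" .
    have "pm * (f' y)\<^sup>2 \<le> p y * (f' y)\<^sup>2" by (intro mult_right_mono pm y) auto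
    moreover have "0 \<le> q y * (f y)\<^sup>2" by (intro mult_nonneg_nonneg qn y) auto
    ultimately show "pm * (f' y)\<^sup>2 - (1 / (2 * s) * (g y)\<^sup>2 + s / 2 * (l * E)) \<le>
        (q y * f y - g y) * f y + f' y * (p y * f' y)"
      using a by (simp add: algebra_simps power2_eq_square)
  qed (intro ci)+
  finally have "pm * E - (1 / (2 * s) * G + s / 2 * (l * (l * E))) \<le> 0" using i0 by simp
  moreover have "s / 2 * (l * (l * E)) = pm * E / 2" "1 / (2 * s) * G = l\<^sup>2 * G / (2 * pm)"
    using l pm by (simp_all add: s_def power2_eq_square)
  ultimately have "pm * E \<le> 2 * (l\<^sup>2 * G / (2 * pm))" by linarith
  then have "E \<le> l\<^sup>2 * G / pm\<^sup>2" using pm by (simp add: field_simps power2_eq_square)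
  then have "l * E \<le> l * (l\<^sup>2 * G / pm\<^sup>2)" using l by (intro mult_left_mono) auto
  then show ?thesis
    using point[OF x] unfolding G_def by (simp add: power3_eq_cube power2_eq_square mult.assoc)
qed

section \<open>Square integrable functions and orthonormal systems\<close>
lemma continuous_on_LINT_Ioo:
  fixes f :: "real \<Rightarrow> real"
  assumes "continuous_on {0..l} f"
  shows "integrable (lebesgue_on {0<..<l}) f" "(LINT x|lebesgue_on {0<..<l}. f x) = integral {0..l} f"
proof -
  have "set_integrable lebesgue {0..l} f"
    using continuous_imp_integrable_real[OF assms] by (simp add: integrable_restrict_space set_integrable_def)
  then have "set_integrable lebesgue {0<..<l} f"
    by (rule set_integrable_subset) auto
  then show 1: "integrable (lebesgue_on {0<..<l}) f"
    by (simp add: integrable_restrict_space set_integrable_def)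
  show "(LINT x|lebesgue_on {0<..<l}. f x) = integral {0..l} f"
    using lebesgue_integral_eq_integral[OF 1] by (simp add: integral_open_interval_real)
qed

lemma L2_fun_continuous:
  assumes "continuous_on {0..l} f" shows "L2_fun l f"
  using continuous_on_LINT_Ioo(1)[OF assms] continuous_on_LINT_Ioo(1)[of l "\<lambda>x. (f x)\<^sup>2"] assms
  by (auto simp: L2_fun_def intro: continuous_intros)

lemma L2_fun_mult_integrable:
  assumes "L2_fun l f" "L2_fun l g"
  shows "integrable (lebesgue_on {0<..<l}) (\<lambda>x. f x * g x)"
proof (rule Bochner_Integration.integrable_bound)
  show "integrable (lebesgue_on {0<..<l}) (\<lambda>x. (f x)\<^sup>2 + (g x)\<^sup>2)"
    using assms unfolding L2_fun_def by (intro Bochner_Integration.integrable_add) simp_all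
  show "(\<lambda>x. f x * g x) \<in> borel_measurable (lebesgue_on {0<..<l})"
    using assms by (intro borel_measurable_times) (auto simp: L2_fun_def)
  have "\<bar>a * b\<bar> \<le> a\<^sup>2 + b\<^sup>2" for a b :: real
  proof -
    have "2 * \<bar>a\<bar> * \<bar>b\<bar> \<le> a\<^sup>2 + b\<^sup>2" using sum_squares_bound[of "\<bar>a\<bar>" "\<bar>b\<bar>"] by simp
    moreover have "0 \<le> \<bar>a\<bar> * \<bar>b\<bar>" by simp
    ultimately show ?thesis unfolding abs_mult by linarith
  qed
  then show "AE x in lebesgue_on {0<..<l}. norm (f x * g x) \<le> norm ((f x)\<^sup>2 + (g x)\<^sup>2)"
    by (intro AE_I2) simp
qed

lemma L2_fun_diff:
  assumes "L2_fun l f" "L2_fun l g"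
  shows "L2_fun l (\<lambda>x. f x - g x)"
proof -
  have "integrable (lebesgue_on {0<..<l}) (\<lambda>x. (f x)\<^sup>2 + (g x)\<^sup>2 - 2 * (f x * g x))"
    using assms L2_fun_mult_integrable[OF assms] unfolding L2_fun_def by auto
  then show ?thesis using assms by (auto simp: L2_fun_def power2_diff mult.assoc)
qed

lemma L2_inner_sum_right:
  assumes "L2_fun l f" "\<And>i. i \<in> F \<Longrightarrow> L2_fun l (X i)"
  shows "L2_inner l f (\<lambda>x. \<Sum>i\<in>F. c i * X i x) = (\<Sum>i\<in>F. c i * L2_inner l f (X i))"
proof -
  have "f x * (\<Sum>i\<in>F. c i * X i x) = (\<Sum>i\<in>F. c i * (f x * X i x))" for x
    by (simp add: sum_distrib_left mult.left_commute)
  then have "L2_inner l f (\<lambda>x. \<Sum>i\<in>F. c i * X i x) = (LINT x|lebesgue_on {0<..<l}. (\<Sum>i\<in>F. c i * (f x * X i x)))"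
    by (simp only: L2_inner_def)
  also have "\<dots> = (\<Sum>i\<in>F. (LINT x|lebesgue_on {0<..<l}. c i * (f x * X i x)))"
    by (intro Bochner_Integration.integral_sum integrable_mult_right
        L2_fun_mult_integrable[OF assms(1) assms(2)])
  also have "\<dots> = (\<Sum>i\<in>F. c i * L2_inner l f (X i))"
    by (simp add: L2_inner_def)
  finally show ?thesis .
qed

lemma L2_inner_commute: "L2_inner l f g = L2_inner l g f"
  by (simp add: L2_inner_def mult.commute)

lemma L2_fun_sum:
  assumes "finite F" "\<And>i. i \<in> F \<Longrightarrow> L2_fun l (X i)"
  shows "L2_fun l (\<lambda>x. \<Sum>i\<in>F. c i * X i x)"
  using assms
proof (induction F)
  case empty
  then show ?case by (simp add: L2_fun_def)
next
  case (insert a F)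
  have "L2_fun l (X a)" by (rule insert.prems) simp
  then have a: "L2_fun l (\<lambda>x. - c a * X a x)"
    unfolding L2_fun_def power_mult_distrib
    by (intro conjI borel_measurable_times borel_measurable_const integrable_mult_right) simp_all
  have "L2_fun l (\<lambda>x. \<Sum>i\<in>F. c i * X i x)"
    by (rule insert.IH) (rule insert.prems, simp)
  from L2_fun_diff[OF this a] show ?case
    using insert.hyps by (simp add: add.commute)
qed

lemma L2_inner_orthonormal_sum:
  assumes "finite F" "\<And>i. i \<in> F \<Longrightarrow> L2_fun l (X i)"
    and "\<And>i j. i \<in> F \<Longrightarrow> j \<in> F \<Longrightarrow> L2_inner l (X i) (X j) = (if i = j then 1 else 0)"
  shows "L2_inner l (\<lambda>x. \<Sum>i\<in>F. c i * X i x) (\<lambda>x. \<Sum>i\<in>F. c i * X i x) = (\<Sum>i\<in>F. (c i)\<^sup>2)"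
proof -
  have "L2_inner l (\<lambda>x. \<Sum>i\<in>F. c i * X i x) (X j) = c j" if "j \<in> F" for j
  proof -
    have "L2_inner l (\<lambda>x. \<Sum>i\<in>F. c i * X i x) (X j) = (\<Sum>i\<in>F. c i * L2_inner l (X j) (X i))"
      unfolding L2_inner_commute[of l _ "X j"] by (rule L2_inner_sum_right[OF assms(2)[OF that] assms(2)])
    also have "\<dots> = (\<Sum>i\<in>F. if j = i then c i else 0)"
      by (rule sum.cong[OF refl]) (simp add: assms(3)[OF that])
    also have "\<dots> = c j" using that assms(1) by (simp add: sum.delta)
    finally show ?thesis .
  qed
  then show ?thesis
    by (subst L2_inner_sum_right[OF L2_fun_sum[OF assms(1,2)] assms(2)]) (simp_all add: power2_eq_square)
qed

lemma Bessel_inequality: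
  assumes "finite F" "L2_fun l h" "\<And>i. i \<in> F \<Longrightarrow> L2_fun l (X i)"
    and "\<And>i j. i \<in> F \<Longrightarrow> j \<in> F \<Longrightarrow> L2_inner l (X i) (X j) = (if i = j then 1 else 0)"
  shows "(\<Sum>i\<in>F. (L2_inner l h (X i))\<^sup>2) \<le> L2_inner l h h"
proof -
  define S where "S x = (\<Sum>i\<in>F. L2_inner l h (X i) * X i x)" for x
  have S: "L2_fun l S" unfolding S_def by (rule L2_fun_sum[OF assms(1,3)])
  have hS: "L2_inner l h S = (\<Sum>i\<in>F. (L2_inner l h (X i))\<^sup>2)"
    unfolding S_def by (subst L2_inner_sum_right[OF assms(2,3)]) (simp_all add: power2_eq_square)
  have SS: "L2_inner l S S = (\<Sum>i\<in>F. (L2_inner l h (X i))\<^sup>2)"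
    unfolding S_def by (rule L2_inner_orthonormal_sum[OF assms(1,3,4)])
  have "0 \<le> (LINT x|lebesgue_on {0<..<l}. (h x - S x)\<^sup>2)" by simp
  also have "\<dots> = (LINT x|lebesgue_on {0<..<l}. h x * h x - 2 * (h x * S x) + S x * S x)"
    by (intro Bochner_Integration.integral_cong refl) (simp add: power2_eq_square algebra_simps)
  also have "\<dots> = L2_inner l h h - 2 * L2_inner l h S + L2_inner l S S"
    using L2_fun_mult_integrable[OF assms(2,2)] L2_fun_mult_integrable[OF assms(2) S]
      L2_fun_mult_integrable[OF S S]
    by (simp add: L2_inner_def)
  finally show ?thesis using hS SS by simp
qed

text \<open>
  Green's identity: \<open>p f' X - p X' f\<close> vanishes at both end points and has the derivative \<open>\<mu> f X - g X\<close>.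
  It is stated for square integrable \<open>g\<close> in order to cover \<open>f = L(u\<^sub>0)\<close>, \<open>g = L(L(u\<^sub>0))\<close>.
\<close>
lemma dirichlet_solution_Green:
  assumes l: "0 < l" and contp: "continuous_on {0..l} p"
    and f: "dirichlet_solution p q l f f' g" and g: "L2_fun l g"
    and X: "dirichlet_solution p q l X X' (\<lambda>x. \<mu> * X x)"
  shows "L2_inner l g X = \<mu> * L2_inner l f X"
proof -
  note D = dirichlet_solutionD[OF f] and E = dirichlet_solutionD[OF X]
  have "((\<lambda>y. \<mu> * (f y * X y) - g y * X y) has_integral
      ((p l * f' l * X l - p l * X' l * f l) - (p 0 * f' 0 * X 0 - p 0 * X' 0 * f 0))) {0..l}"
  proof (rule fundamental_theorem_of_calculus_interior)
    show "continuous_on {0..l} (\<lambda>y. p y * f' y * X y - p y * X' y * f y)"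
      by (intro continuous_intros D E contp)
    fix y assume y: "y \<in> {0<..<l}"
    show "((\<lambda>y. p y * f' y * X y - p y * X' y * f y) has_vector_derivative
        \<mu> * (f y * X y) - g y * X y) (at y)"
      unfolding has_real_derivative_iff_has_vector_derivative[symmetric]
      by (rule DERIV_cong[OF DERIV_diff[OF DERIV_mult[OF D(5) E(4)] DERIV_mult[OF E(5) D(4)]]])
        (use y in \<open>auto simp: algebra_simps\<close>)
  qed (use l in auto)
  then have "((\<lambda>y. \<mu> * (f y * X y) - g y * X y) has_integral 0) {0<..<l}"
    using D(6,7) E(6,7) by (simp add: has_integral_Icc_iff_Ioo)
  then have "integral {0<..<l} (\<lambda>y. \<mu> * (f y * X y) - g y * X y) = 0" by (rule integral_unique)
  moreover have i1: "integrable (lebesgue_on {0<..<l}) (\<lambda>y. f y * X y)"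
    by (intro L2_fun_mult_integrable L2_fun_continuous D E)
  moreover have i2: "integrable (lebesgue_on {0<..<l}) (\<lambda>y. g y * X y)"
    by (intro L2_fun_mult_integrable L2_fun_continuous D E g)
  moreover have i3: "integrable (lebesgue_on {0<..<l}) (\<lambda>y. \<mu> * (f y * X y) - g y * X y)"
    using i1 i2 by simp
  ultimately have "(LINT y|lebesgue_on {0<..<l}. \<mu> * (f y * X y) - g y * X y) = 0"
    using lebesgue_integral_eq_integral[OF i3] by simp
  then show ?thesis using i1 i2 by (simp add: L2_inner_def)
qed

section \<open>Uniformly convergent series and continuous functions\<close>
lemma has_real_derivative_open_cong:
  assumes "(f has_real_derivative D) (at x)" "open S" "x \<in> S" "\<And>y. y \<in> S \<Longrightarrow> f y = g y"
  shows "(g has_real_derivative D) (at x)"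
  using has_field_derivative_transform_within_open[OF assms(1-3)] assms(4) by blast

text \<open>
  Used to freeze one of the variables in a series that converges uniformly in two.
\<close>
lemma uniformly_convergent_on_sum_reindex:
  fixes f :: "nat \<Rightarrow> 'b \<Rightarrow> real"
  assumes "uniformly_convergent_on B (\<lambda>n z. \<Sum>i<n. f i z)"
    and "\<And>s. s \<in> A \<Longrightarrow> k s \<in> B" and "\<And>i s. s \<in> A \<Longrightarrow> g i s = f i (k s)"
  shows "uniformly_convergent_on A (\<lambda>n s. \<Sum>i<n. g i s)"
  unfolding uniformly_convergent_on_sum_iff
proof (intro allI impI)
  fix \<epsilon> :: real assume "\<epsilon> > 0"
  from uniformly_convergent_on_sum_E[OF assms(1) this]
  obtain N where N: "\<And>m n z. N \<le> m \<Longrightarrow> m \<le> n \<Longrightarrow> z \<in> B \<Longrightarrow> norm (\<Sum>i=m..<n. f i z) < \<epsilon>" by blast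
  show "\<exists>N. \<forall>m n z. N \<le> m \<longrightarrow> m \<le> n \<longrightarrow> z \<in> A \<longrightarrow> norm (\<Sum>i=m..<n. g i z) < \<epsilon>"
  proof (intro exI allI impI)
    fix m n s assume "N \<le> m" "m \<le> n" "s \<in> A"
    then show "norm (\<Sum>i=m..<n. g i s) < \<epsilon>"
      using N[of m n "k s"] assms(2)[of s] assms(3)[of s] by simp
  qed
qed

lemma uniformly_convergent_on_sum_summable:
  fixes f :: "nat \<Rightarrow> 'b \<Rightarrow> real"
  assumes "uniformly_convergent_on B (\<lambda>n z. \<Sum>i<n. f i z)" "z \<in> B"
  shows "summable (\<lambda>i. f i z)"
  using uniformly_convergent_imp_convergent[OF assms] by (simp add: summable_iff_convergent)

lemma continuous_on_suminf_uniformly_convergent: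
  fixes f :: "nat \<Rightarrow> 'b::topological_space \<Rightarrow> real"
  assumes "uniformly_convergent_on B (\<lambda>n z. \<Sum>i<n. f i z)" "\<And>i. continuous_on B (f i)"
  shows "continuous_on B (\<lambda>z. \<Sum>i. f i z)"
proof (rule uniform_limit_theorem[OF always_eventually[OF allI]])
  show "uniform_limit B (\<lambda>n z. \<Sum>i<n. f i z) (\<lambda>z. \<Sum>i. f i z) sequentially"
    using assms(1) by (simp add: uniformly_convergent_uniform_limit_iff suminf_eq_lim)
  show "continuous_on B (\<lambda>z. \<Sum>i<n. f i z)" for n
    by (intro continuous_intros assms(2))
qed simp

text \<open>
  The set where \<open>f\<close> does not vanish is open, and a nonempty open set is not negligible.
\<close>
lemma continuous_AE_zero:
  fixes f :: "real \<Rightarrow> real"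
  assumes "continuous_on {a<..<b} f" "AE x in lebesgue_on {a<..<b}. f x = 0" "x \<in> {a<..<b}"
  shows "f x = 0"
proof (rule ccontr)
  assume "f x \<noteq> 0"
  define S where "S = {a<..<b} \<inter> f -` (- {0})"
  have "open S"
    unfolding S_def by (intro continuous_open_preimage assms(1)) auto
  moreover have "S \<noteq> {}" using \<open>f x \<noteq> 0\<close> assms(3) by (auto simp: S_def)
  moreover have "negligible S"
  proof -
    have "AE x in lebesgue. x \<in> {a<..<b} \<longrightarrow> f x = 0"
      using assms(2) by (subst (asm) AE_restrict_space_iff) auto
    then obtain N where N: "N \<in> null_sets lebesgue" "{x. \<not> (x \<in> {a<..<b} \<longrightarrow> f x = 0)} \<subseteq> N"
      by (auto simp: eventually_ae_filter)
    then have "negligible N" by (simp add: negligible_iff_null_sets)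
    then show ?thesis by (rule negligible_subset) (use N(2) in \<open>auto simp: S_def\<close>)
  qed
  ultimately show False using open_not_negligible by blast
qed

section \<open>Eigenfunction expansions\<close>
locale sturm_liouville =
  fixes p q :: "real \<Rightarrow> real" and l :: real and lam :: "nat \<Rightarrow> real" and X :: "nat \<Rightarrow> real \<Rightarrow> real"
  assumes l_pos: "0 < l" and p_C1: "C1_closed 0 l p" and q_cont: "continuous_on {0..l} q"
    and p_pos: "\<forall>x\<in>{0..l}. 0 < p x" and q_nonneg: "\<forall>x\<in>{0..l}. 0 \<le> q x"
    and eigen: "eigen_system p q l lam X"
begin

lemma p_cont: "continuous_on {0..l} p"
  using p_C1 by (rule C1_closed_imp_continuous_on)

lemma p_lower_bound: obtains pm where "0 < pm" "\<And>x. x \<in> {0..l} \<Longrightarrow> pm \<le> p x"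
proof -
  obtain z where "z \<in> {0..l}" "\<And>x. x \<in> {0..l} \<Longrightarrow> p z \<le> p x"
    using continuous_attains_inf[OF compact_Icc _ p_cont] l_pos by auto
  with p_pos that show thesis by blast
qed

lemma q_upper_bound: obtains Q where "0 \<le> Q" "\<And>x. x \<in> {0..l} \<Longrightarrow> q x \<le> Q"
proof -
  obtain z where "z \<in> {0..l}" "\<And>x. x \<in> {0..l} \<Longrightarrow> q x \<le> q z"
    using continuous_attains_sup[OF compact_Icc _ q_cont] l_pos by auto
  with q_nonneg that show thesis by blast
qed

lemma lam_ge: "lam 0 \<le> lam i" and lam_pos: "0 < lam i"
proof -
  show "lam 0 \<le> lam i" using eigen by (auto simp: eigen_system_def incseq_def)
  then show "0 < lam i" using eigen by (auto simp: eigen_system_def)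
qed

text \<open>
  The derivative of \<open>X i\<close>, one-sided at the end points; being unique there, it does not depend on the
  choice.
\<close>
definition DX :: "nat \<Rightarrow> real \<Rightarrow> real" where
  "DX i = (SOME f'. dirichlet_solution p q l (X i) f' (\<lambda>x. lam i * X i x))"

lemma X_dirichlet_solution: "dirichlet_solution p q l (X i) (DX i) (\<lambda>x. lam i * X i x)"
proof -
  have "\<exists>f'. dirichlet_solution p q l (X i) f' (\<lambda>x. lam i * X i x)"
    using eigen by (intro M_space_dirichlet_solution p_C1) (auto simp: eigen_system_def)
  then show ?thesis unfolding DX_def by (rule someI_ex)
qed

lemmas X_D = dirichlet_solutionD[OF X_dirichlet_solution]

lemma X_L2: "L2_fun l (X i)"
  by (intro L2_fun_continuous X_D)

lemma X_orthonormal: "L2_inner l (X i) (X j) = (if i = j then 1 else 0)"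
  using eigen by (auto simp: eigen_system_def)

text \<open>
  The sup-norm bound applied to \<open>f = \<Sum> a\<^sub>i X\<^sub>i\<close>, \<open>L(f) = \<Sum> \<lambda>\<^sub>i a\<^sub>i X\<^sub>i\<close>; the norm of \<open>L(f)\<close> is computed from
  orthonormality.
\<close>
lemma eigen_sum_sup_bound:
  obtains C where "0 < C" "\<And>F a x. finite F \<Longrightarrow> x \<in> {0..l} \<Longrightarrow>
      (\<Sum>i\<in>F. a i * X i x)\<^sup>2 \<le> C * (\<Sum>i\<in>F. (lam i * a i)\<^sup>2)"
proof -
  obtain pm where pm: "0 < pm" "\<And>x. x \<in> {0..l} \<Longrightarrow> pm \<le> p x" using p_lower_bound by blast
  have "(\<Sum>i\<in>F. a i * X i x)\<^sup>2 \<le> l^3 / pm\<^sup>2 * (\<Sum>i\<in>F. (lam i * a i)\<^sup>2)"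
    if F: "finite F" and x: "x \<in> {0..l}" for F a x
  proof -
    define g where "g y = (\<Sum>i\<in>F. (lam i * a i) * X i y)" for y
    have g: "continuous_on {0..l} g" unfolding g_def by (intro continuous_intros X_D)
    have "dirichlet_solution p q l (\<lambda>x. \<Sum>i\<in>F. a i * X i x) (\<lambda>x. \<Sum>i\<in>F. a i * DX i x)
            (\<lambda>x. \<Sum>i\<in>F. a i * (lam i * X i x))"
      by (intro dirichlet_solution_sum X_dirichlet_solution)
    also have "(\<lambda>x. \<Sum>i\<in>F. a i * (lam i * X i x)) = g" by (simp add: g_def[abs_def] mult_ac)
    finally have "(\<Sum>i\<in>F. a i * X i x)\<^sup>2 \<le> l^3 / pm\<^sup>2 * integral {0..l} (\<lambda>y. (g y)\<^sup>2)"
      using q_nonneg by (intro dirichlet_solution_sup_bound[OF l_pos p_cont q_cont pm _ _ g x]) auto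
    also have "integral {0..l} (\<lambda>y. (g y)\<^sup>2) = L2_inner l g g"
      unfolding L2_inner_def using g
      by (subst continuous_on_LINT_Ioo(2)) (auto simp: power2_eq_square intro: continuous_intros)
    also have "\<dots> = (\<Sum>i\<in>F. (lam i * a i)\<^sup>2)"
      unfolding g_def[abs_def] by (rule L2_inner_orthonormal_sum[OF F X_L2 X_orthonormal])
    finally show ?thesis .
  qed
  moreover have "0 < l^3 / pm\<^sup>2" using l_pos pm by simp
  ultimately show thesis using that by blast
qed

text \<open>
  A bound for all partial sums that does not depend on the coefficients: it serves as the dominating
  function when such a series is integrated.
\<close>
lemma eigen_series_partial_sum_bound:
  assumes h: "summable (\<lambda>i. (h i)\<^sup>2)"
  shows "\<exists>K. \<forall>a n x. (\<forall>i. \<bar>lam i * a i\<bar> \<le> h i) \<longrightarrow> x \<in> {0..l} \<longrightarrow> \<bar>\<Sum>i<n. a i * X i x\<bar> \<le> K"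
proof -
  obtain C where C: "0 < C" "\<And>F a x. finite F \<Longrightarrow> x \<in> {0..l} \<Longrightarrow>
      (\<Sum>i\<in>F. a i * X i x)\<^sup>2 \<le> C * (\<Sum>i\<in>F. (lam i * a i)\<^sup>2)"
    using eigen_sum_sup_bound by blast
  have "\<bar>\<Sum>i<n. a i * X i x\<bar> \<le> sqrt (C * (\<Sum>i. (h i)\<^sup>2))"
    if a: "\<forall>i. \<bar>lam i * a i\<bar> \<le> h i" and x: "x \<in> {0..l}" for a n x
  proof -
    have "(\<Sum>i<n. (lam i * a i)\<^sup>2) \<le> (\<Sum>i<n. (h i)\<^sup>2)"
      by (intro sum_mono) (metis a abs_ge_zero power2_abs power_mono)
    also have "\<dots> \<le> (\<Sum>i. (h i)\<^sup>2)" by (intro sum_le_suminf h) auto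
    finally have "C * (\<Sum>i<n. (lam i * a i)\<^sup>2) \<le> C * (\<Sum>i. (h i)\<^sup>2)"
      using C(1) by (intro mult_left_mono) auto
    with C(2)[OF finite_lessThan x, of a n] have "(\<Sum>i<n. a i * X i x)\<^sup>2 \<le> C * (\<Sum>i. (h i)\<^sup>2)"
      by linarith
    then show ?thesis by (metis real_sqrt_abs real_sqrt_le_mono)
  qed
  then show ?thesis by blast
qed

text \<open>
  Cauchy's criterion: the block from \<open>m\<close> to \<open>n\<close> is at most \<open>C \<Sum> h\<^sub>i\<^sup>2\<close> in the square of the sup norm,
  uniformly in the parameter \<open>b\<close>.
\<close>
lemma eigen_series_uniformly_convergent:
  assumes h: "summable (\<lambda>i. (h i)\<^sup>2)" and a: "\<And>i b. b \<in> B \<Longrightarrow> \<bar>lam i * a i b\<bar> \<le> h i"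
  shows "uniformly_convergent_on ({0..l} \<times> B) (\<lambda>n z. \<Sum>i<n. a i (snd z) * X i (fst z))"
  unfolding uniformly_convergent_on_sum_iff
proof (intro allI impI)
  fix \<epsilon> :: real assume "\<epsilon> > 0"
  obtain C where C: "0 < C" "\<And>F a x. finite F \<Longrightarrow> x \<in> {0..l} \<Longrightarrow>
      (\<Sum>i\<in>F. a i * X i x)\<^sup>2 \<le> C * (\<Sum>i\<in>F. (lam i * a i)\<^sup>2)"
    using eigen_sum_sup_bound by blast
  obtain N where N: "\<And>m n. m \<ge> N \<Longrightarrow> norm (\<Sum>i=m..<n. (h i)\<^sup>2) < \<epsilon>\<^sup>2 / C"
    using h \<open>\<epsilon> > 0\<close> C(1) unfolding summable_Cauchy by (metis divide_pos_pos zero_less_power)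
  show "\<exists>N. \<forall>m n z. N \<le> m \<longrightarrow> m \<le> n \<longrightarrow> z \<in> {0..l} \<times> B \<longrightarrow>
      norm (\<Sum>i=m..<n. a i (snd z) * X i (fst z)) < \<epsilon>"
  proof (intro exI allI impI)
    fix m n z assume m: "N \<le> m" and z: "z \<in> {0..l} \<times> B"
    then have x: "fst z \<in> {0..l}" and b: "snd z \<in> B" by auto
    have "(\<Sum>i=m..<n. (lam i * a i (snd z))\<^sup>2) \<le> (\<Sum>i=m..<n. (h i)\<^sup>2)"
      by (intro sum_mono) (metis a[OF b] abs_ge_zero power2_abs power_mono)
    also have "\<dots> < \<epsilon>\<^sup>2 / C" using N[OF m, of n] by simp
    finally have "C * (\<Sum>i=m..<n. (lam i * a i (snd z))\<^sup>2) < \<epsilon>\<^sup>2"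
      using C(1) by (simp add: field_simps)
    with C(2)[OF finite_atLeastLessThan x, of "\<lambda>i. a i (snd z)" m n]
    have "(\<Sum>i=m..<n. a i (snd z) * X i (fst z))\<^sup>2 < \<epsilon>\<^sup>2" by linarith
    then show "norm (\<Sum>i=m..<n. a i (snd z) * X i (fst z)) < \<epsilon>"
      using \<open>\<epsilon> > 0\<close> by (metis abs_le_square_iff not_le real_norm_def abs_of_pos)
  qed
qed

lemma eigen_series_uniformly_convergent_single:
  assumes h: "summable (\<lambda>i. (h i)\<^sup>2)" and a: "\<And>i. \<bar>lam i * a i\<bar> \<le> h i"
  shows "uniformly_convergent_on {0..l} (\<lambda>n x. \<Sum>i<n. a i * X i x)"
proof -
  have "uniformly_convergent_on ({0..l} \<times> {()}) (\<lambda>n z. \<Sum>i<n. a i * X i (fst z))"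
    using eigen_series_uniformly_convergent[of h "{()}" "\<lambda>i _. a i"] h a by simp
  then show ?thesis unfolding uniformly_convergent_on_sum_iff by fastforce
qed

text \<open>
  The eigenvalues are bounded below by the first one, so that one power of \<open>\<lambda>\<^sub>i\<close> can be given away.
\<close>
lemma coefficient_decay_weaken:
  assumes h: "summable (\<lambda>i. (h i)\<^sup>2)" and a: "\<And>i. \<bar>lam i * (lam i * a i)\<bar> \<le> h i"
  shows "summable (\<lambda>i. (h i / lam 0)\<^sup>2)" "\<bar>lam i * a i\<bar> \<le> h i / lam 0"
proof -
  show "summable (\<lambda>i. (h i / lam 0)\<^sup>2)"
    using h by (simp add: power_divide summable_divide)
  have "lam 0 * \<bar>lam i * a i\<bar> \<le> lam i * \<bar>lam i * a i\<bar>"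
    by (intro mult_right_mono lam_ge) auto
  also have "\<dots> = \<bar>lam i * (lam i * a i)\<bar>"
    using lam_pos[of i] by (simp add: abs_mult)
  also have "\<dots> \<le> h i" by (rule a)
  finally show "\<bar>lam i * a i\<bar> \<le> h i / lam 0"
    using lam_pos[of 0] by (simp add: field_simps)
qed

text \<open>
  Blocks of \<open>\<Sum> a\<^sub>i (q - \<lambda>\<^sub>i) X\<^sub>i\<close>, the formal derivative of the flux \<open>\<Sum> a\<^sub>i p X\<^sub>i'\<close>, are uniformly small.
\<close>
lemma eigen_series_residual_small:
  assumes h: "summable (\<lambda>i. (h i)\<^sup>2)" and a: "\<And>i. \<bar>lam i * (lam i * a i)\<bar> \<le> h i" and \<epsilon>: "0 < \<epsilon>"
  obtains N where "\<And>m n x. N \<le> m \<Longrightarrow> m \<le> n \<Longrightarrow> x \<in> {0..l} \<Longrightarrow>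
     \<bar>q x * (\<Sum>i=m..<n. a i * X i x) - (\<Sum>i=m..<n. a i * (lam i * X i x))\<bar> < \<epsilon>"
proof -
  obtain Q where Q: "0 \<le> Q" "\<And>x. x \<in> {0..l} \<Longrightarrow> q x \<le> Q" using q_upper_bound by blast
  have \<epsilon>1: "0 < \<epsilon> / (Q + 1)" using \<epsilon> Q by simp
  obtain N1 where N1: "\<And>m n x. N1 \<le> m \<Longrightarrow> m \<le> n \<Longrightarrow> x \<in> {0..l} \<Longrightarrow> norm (\<Sum>i=m..<n. a i * X i x) < \<epsilon> / (Q + 1)"
    using uniformly_convergent_on_sum_E[OF eigen_series_uniformly_convergent_single[OF
        coefficient_decay_weaken[OF h a]] \<epsilon>1] by blast
  obtain N2 where N2: "\<And>m n x. N2 \<le> m \<Longrightarrow> m \<le> n \<Longrightarrow> x \<in> {0..l} \<Longrightarrow> norm (\<Sum>i=m..<n. (lam i * a i) * X i x) < \<epsilon> / (Q + 1)"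
    using uniformly_convergent_on_sum_E[OF eigen_series_uniformly_convergent_single[OF h a] \<epsilon>1] by blast
  show thesis
  proof (rule that)
    fix m n x assume *: "max N1 N2 \<le> m" "m \<le> n" "x \<in> {0..l}"
    define s1 where "s1 = (\<Sum>i=m..<n. a i * X i x)"
    define s2 where "s2 = (\<Sum>i=m..<n. a i * (lam i * X i x))"
    have s1: "\<bar>s1\<bar> < \<epsilon> / (Q + 1)" using N1[of m n x] * by (simp add: s1_def)
    have s2: "\<bar>s2\<bar> < \<epsilon> / (Q + 1)" using N2[of m n x] * by (simp add: s2_def mult_ac)
    (* The tolerance \<epsilon> / (Q + 1) is used Q times for q * s1 and once for s2. *)
    have "\<bar>q x * s1\<bar> \<le> Q * (\<epsilon> / (Q + 1))"
      unfolding abs_mult using Q * q_nonneg s1 by (intro mult_mono) auto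
    then have "\<bar>q x * s1 - s2\<bar> < Q * (\<epsilon> / (Q + 1)) + \<epsilon> / (Q + 1)" using s2 by linarith
    also have "\<dots> = (Q + 1) * (\<epsilon> / (Q + 1))" by (simp only: distrib_right mult_1)
    also have "\<dots> = \<epsilon>" using Q by simp
    finally show "\<bar>q x * s1 - s2\<bar> < \<epsilon>" .
  qed
qed

text \<open>
  The flux bound applied to the blocks of the series, followed by division by \<open>p \<ge> pm > 0\<close>.
\<close>
lemma eigen_series_deriv_uniformly_convergent:
  assumes h: "summable (\<lambda>i. (h i)\<^sup>2)" and a: "\<And>i. \<bar>lam i * (lam i * a i)\<bar> \<le> h i"
  shows "uniformly_convergent_on {0..l} (\<lambda>n x. \<Sum>i<n. a i * DX i x)"
  unfolding uniformly_convergent_on_sum_iff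
proof (intro allI impI)
  fix \<epsilon> :: real assume "\<epsilon> > 0"
  obtain pm where pm: "0 < pm" "\<And>x. x \<in> {0..l} \<Longrightarrow> pm \<le> p x" using p_lower_bound by blast
  define K where "K = \<epsilon> * pm / (2 * l)"
  have "K > 0" using \<open>\<epsilon> > 0\<close> pm l_pos by (simp add: K_def)
  from eigen_series_residual_small[OF h a this] obtain N where
    N: "\<And>m n x. N \<le> m \<Longrightarrow> m \<le> n \<Longrightarrow> x \<in> {0..l} \<Longrightarrow>
     \<bar>q x * (\<Sum>i=m..<n. a i * X i x) - (\<Sum>i=m..<n. a i * (lam i * X i x))\<bar> < K" by blast
  show "\<exists>N. \<forall>m n z. N \<le> m \<longrightarrow> m \<le> n \<longrightarrow> z \<in> {0..l} \<longrightarrow> norm (\<Sum>i=m..<n. a i * DX i z) < \<epsilon>"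
  proof (intro exI allI impI)
    fix m n x assume *: "N \<le> m" "m \<le> n" "x \<in> {0..l}"
    define d where "d = (\<Sum>i=m..<n. a i * DX i x)"
    have "dirichlet_solution p q l (\<lambda>x. \<Sum>i=m..<n. a i * X i x) (\<lambda>x. \<Sum>i=m..<n. a i * DX i x)
            (\<lambda>x. \<Sum>i=m..<n. a i * (lam i * X i x))"
      by (intro dirichlet_solution_sum X_dirichlet_solution)
    then have "\<bar>p x * d\<bar> \<le> l * K"
      unfolding d_def using N[OF *(1,2)] *(3)
      by (intro dirichlet_solution_flux_bound[OF l_pos p_cont]) (auto intro: less_imp_le)
    also have "\<dots> = pm * (\<epsilon> / 2)" using l_pos by (simp add: K_def)
    finally have "p x * \<bar>d\<bar> \<le> pm * (\<epsilon> / 2)"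
      using pm(1) pm(2)[OF *(3)] by (simp add: abs_mult)
    moreover have "pm * \<bar>d\<bar> \<le> p x * \<bar>d\<bar>" by (intro mult_right_mono pm(2) *(3)) auto
    ultimately have "pm * \<bar>d\<bar> \<le> pm * (\<epsilon> / 2)" by linarith
    then have "\<bar>d\<bar> \<le> \<epsilon> / 2" using pm(1) by simp
    then show "norm (\<Sum>i=m..<n. a i * DX i x) < \<epsilon>"
      using \<open>\<epsilon> > 0\<close> by (simp add: d_def)
  qed
qed

text \<open>
  If \<open>h\<close> dominates \<open>\<lambda>\<^sub>i\<^sup>2 a\<^sub>i\<close>, both the series and the flux \<open>\<Sum> a\<^sub>i p X\<^sub>i'\<close> may be differentiated term by
  term.  The second derivative of the sum is then obtained from the flux by the quotient rule.
\<close>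
lemma eigen_series_classical:
  assumes h: "summable (\<lambda>i. (h i)\<^sup>2)" and a: "\<And>i. \<bar>lam i * (lam i * a i)\<bar> \<le> h i"
  defines "U \<equiv> \<lambda>x. \<Sum>i. a i * X i x" and "W \<equiv> \<lambda>x. \<Sum>i. (lam i * a i) * X i x"
  shows "C2_open 0 l U"
    and "x \<in> {0<..<l} \<Longrightarrow> deriv (\<lambda>y. p y * deriv U y) x - q x * U x = - W x"
proof -
  let ?S = "{0<..<l}"
  note hw = coefficient_decay_weaken[OF h a]
  note ucU = eigen_series_uniformly_convergent_single[OF hw]
  note ucW = eigen_series_uniformly_convergent_single[OF h a]
  note ucD = eigen_series_deriv_uniformly_convergent[OF h a]
  note summable_at = uniformly_convergent_on_sum_summable[of "{0..l}"]
  define U' where "U' x = (\<Sum>i. a i * DX i x)" for x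
  have x0: "l / 2 \<in> ?S" using l_pos by simp
  have U': "(U has_real_derivative U' x) (at x)" if "x \<in> ?S" for x
    unfolding U_def U'_def
  proof (rule has_field_derivative_series'(2)[of ?S])
    show "((\<lambda>x. a n * X n x) has_real_derivative a n * DX n x) (at x within ?S)" if "x \<in> ?S" for n x
      by (rule has_field_derivative_at_within[OF DERIV_cmult[OF X_D(4)[OF that]]])
    show "uniformly_convergent_on ?S (\<lambda>n x. \<Sum>i<n. a i * DX i x)"
      by (rule uniformly_convergent_on_subset[OF ucD]) auto
    show "summable (\<lambda>n. a n * X n (l/2))" using summable_at[OF ucU] x0 by simp
  qed (use x0 that in \<open>auto simp: interior_open\<close>)
  define F where "F x = p x * U' x" for x
  have F: "(F has_real_derivative q x * U x - W x) (at x)" if x: "x \<in> ?S" for x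
  proof -
    have "((\<lambda>x. \<Sum>i. a i * (p x * DX i x)) has_real_derivative (\<Sum>i. a i * (q x * X i x - lam i * X i x))) (at x)"
    proof (rule has_field_derivative_series'(2)[of ?S])
      show "((\<lambda>x. a n * (p x * DX n x)) has_real_derivative a n * (q x * X n x - lam n * X n x)) (at x within ?S)" if "x \<in> ?S" for n x
        by (rule has_field_derivative_at_within[OF DERIV_cmult[OF X_D(5)[OF that]]])
      show "uniformly_convergent_on ?S (\<lambda>n x. \<Sum>i<n. a i * (q x * X i x - lam i * X i x))"
        unfolding uniformly_convergent_on_sum_iff
      proof (intro allI impI)
        fix \<epsilon> :: real assume "\<epsilon> > 0"
        from eigen_series_residual_small[OF h a this] obtain N where
          N: "\<And>m n x. N \<le> m \<Longrightarrow> m \<le> n \<Longrightarrow> x \<in> {0..l} \<Longrightarrow>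
          \<bar>q x * (\<Sum>i=m..<n. a i * X i x) - (\<Sum>i=m..<n. a i * (lam i * X i x))\<bar> < \<epsilon>" by blast
        have "q x * (\<Sum>i=m..<n. a i * X i x) - (\<Sum>i=m..<n. a i * (lam i * X i x)) =
           (\<Sum>i=m..<n. a i * (q x * X i x - lam i * X i x))" for m n x
          by (simp add: sum_distrib_left sum_subtractf algebra_simps)
        with N have "\<And>m n x. N \<le> m \<Longrightarrow> m \<le> n \<Longrightarrow> x \<in> {0..l} \<Longrightarrow>
          norm (\<Sum>i=m..<n. a i * (q x * X i x - lam i * X i x)) < \<epsilon>" by simp
        then show "\<exists>N. \<forall>m n z. N \<le> m \<longrightarrow> m \<le> n \<longrightarrow> z \<in> ?S \<longrightarrow>
            norm (\<Sum>i=m..<n. a i * (q z * X i z - lam i * X i z)) < \<epsilon>" by fastforce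
      qed
      have "summable (\<lambda>n. p (l/2) * (a n * DX n (l/2)))"
        using summable_at[OF ucD] x0 by (intro summable_mult) simp
      then show "summable (\<lambda>n. a n * (p (l/2) * DX n (l/2)))" by (simp add: mult_ac)
    qed (use x0 x in \<open>auto simp: interior_open\<close>)
    moreover have "(\<Sum>i. a i * (q x * X i x - lam i * X i x)) = q x * U x - W x"
    proof -
      have "(\<lambda>i. q x * (a i * X i x) - (lam i * a i) * X i x) sums (q x * U x - W x)"
        unfolding U_def W_def using x
        by (intro sums_diff sums_mult summable_sums summable_at[OF ucU] summable_at[OF ucW]) auto
      then show ?thesis by (simp add: sums_iff algebra_simps)
    qed
    moreover have "(\<Sum>i. a i * (p y * DX i y)) = F y" if "y \<in> ?S" for y
      using suminf_mult[OF summable_at[OF ucD], of y "p y"] that by (simp add: F_def U'_def mult_ac)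
    ultimately show ?thesis
      using has_real_derivative_open_cong[of _ "q x * U x - W x" x ?S F] x by auto
  qed
  have derivU: "deriv U x = U' x" if "x \<in> ?S" for x
    using U'[OF that] by (rule DERIV_imp_deriv)
  have F': "((\<lambda>y. p y * deriv U y) has_real_derivative q x * U x - W x) (at x)" if "x \<in> ?S" for x
    by (rule has_real_derivative_open_cong[OF F[OF that] _ that]) (auto simp: F_def derivU)
  show "deriv (\<lambda>y. p y * deriv U y) x - q x * U x = - W x" if "x \<in> ?S" for x
    using DERIV_imp_deriv[OF F'[OF that]] by simp
  obtain p' where p': "\<And>x. x \<in> {0..l} \<Longrightarrow> (p has_real_derivative p' x) (at x within {0..l})"
     and p'_cont: "continuous_on {0..l} p'"
    using p_C1 unfolding C1_closed_def by blast
  have p'': "(p has_real_derivative p' x) (at x)" if "x \<in> ?S" for x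
    using p'[of x] that by (simp add: at_within_Icc_at)
  have pnz: "p x \<noteq> 0" if "x \<in> ?S" for x using p_pos[rule_format, of x] that by auto
  have contU: "continuous_on ?S U"
    by (rule DERIV_continuous_on) (rule has_field_derivative_at_within[OF U'])
  have contF: "continuous_on ?S F"
    by (rule DERIV_continuous_on) (rule has_field_derivative_at_within[OF F])
  have contp: "continuous_on ?S p" by (rule continuous_on_subset[OF p_cont]) auto
  have contq: "continuous_on ?S q" by (rule continuous_on_subset[OF q_cont]) auto
  have contp': "continuous_on ?S p'" by (rule continuous_on_subset[OF p'_cont]) auto
  have contU': "continuous_on ?S U'"
  proof -
    have "continuous_on ?S (\<lambda>x. F x / p x)"
      by (intro continuous_intros contF contp) (use pnz in auto)
    then show ?thesis by (rule continuous_on_eq) (use pnz in \<open>auto simp: F_def\<close>)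
  qed
  have contW: "continuous_on ?S W"
  proof -
    have "continuous_on {0..l} W"
      unfolding W_def
      by (rule continuous_on_suminf_uniformly_convergent[OF ucW]) (intro continuous_intros X_D)
    then show ?thesis by (rule continuous_on_subset) auto
  qed
  define U'' where "U'' x = ((q x * U x - W x) * p x - F x * p' x) / (p x * p x)" for x
  have U'': "(deriv U has_real_derivative U'' x) (at x)" if "x \<in> ?S" for x
  proof (rule has_real_derivative_open_cong[of "\<lambda>y. F y / p y" _ _ ?S])
    show "((\<lambda>y. F y / p y) has_real_derivative U'' x) (at x)"
      unfolding U''_def by (rule DERIV_divide[OF F[OF that] p''[OF that] pnz[OF that]])
    show "F y / p y = deriv U y" if "y \<in> ?S" for y
      using pnz[OF that] derivU[OF that] by (simp add: F_def)
  qed (use that in auto)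
  have contU'': "continuous_on ?S U''"
    unfolding U''_def by (intro continuous_intros contU contF contW contp contp' contq) (use pnz in auto)
  show "C2_open 0 l U"
    unfolding C2_open_def C1_differentiable_on_def
    using U' U'' contU' contU'' unfolding has_real_derivative_iff_has_vector_derivative by blast
qed

text \<open>
  \<open>\<lambda>\<^sub>i\<^sup>2 (u\<^sub>0, X\<^sub>i) = \<lambda>\<^sub>i (L(u\<^sub>0), X\<^sub>i) = (L(L(u\<^sub>0)), X\<^sub>i)\<close>; this is where both hypotheses on \<open>u\<^sub>0\<close> enter.
\<close>
lemma M_space_coefficients_decay:
  assumes u0: "u0 \<in> M_space p q l" and Lu0: "L_op_in_M_space p q l u0"
  obtains h where "summable (\<lambda>i. (h i)\<^sup>2)" "\<And>i. \<bar>lam i * (lam i * L2_inner l u0 (X i))\<bar> \<le> h i"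
proof -
  from Lu0 obtain g where g: "g \<in> M_space p q l" "\<And>x. x \<in> {0<..<l} \<Longrightarrow> g x = L_op p q u0 x"
    by (auto simp: L_op_in_M_space_def)
  define k where "k = L_op p q g"
  obtain u0' where u0': "dirichlet_solution p q l u0 u0' g"
    using M_space_dirichlet_solution[OF p_C1 u0 g(2)] by blast
  obtain g' where g': "dirichlet_solution p q l g g' k"
    using M_space_dirichlet_solution[OF p_C1 g(1), of k] by (auto simp: k_def)
  have k: "L2_fun l k" using g(1) by (simp add: M_space_def k_def)
  have g_L2: "L2_fun l g" by (intro L2_fun_continuous dirichlet_solutionD(2)[OF g'])
  have eq: "L2_inner l k (X i) = lam i * (lam i * L2_inner l u0 (X i))" for i
    using dirichlet_solution_Green[OF l_pos p_cont g' k X_dirichlet_solution]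
      dirichlet_solution_Green[OF l_pos p_cont u0' g_L2 X_dirichlet_solution] by simp
  have "summable (\<lambda>i. (L2_inner l k (X i))\<^sup>2)"
    using Bessel_inequality[OF finite_lessThan k X_L2 X_orthonormal]
    by (intro summableI_nonneg_bounded[where x = "L2_inner l k k"]) auto
  then show thesis
    by (intro that[of "\<lambda>i. \<bar>L2_inner l k (X i)\<bar>"]) (auto simp: eq)
qed

text \<open>
  The sum \<open>v\<close> of the Fourier series is continuous and has the same Fourier coefficients as \<open>f\<close>, so
  completeness gives \<open>v = f\<close> almost everywhere on \<open>(0,l)\<close>.  Continuity and the boundary values remove
  the exceptional set.
\<close>
lemma eigen_expansion_sums:
  assumes f: "continuous_on {0..l} f" "f 0 = 0" "f l = 0"
    and h: "summable (\<lambda>i. (h i)\<^sup>2)" and c: "\<And>i. \<bar>lam i * L2_inner l f (X i)\<bar> \<le> h i"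
    and x: "x \<in> {0..l}"
  shows "(\<lambda>i. L2_inner l f (X i) * X i x) sums f x"
proof -
  define v where "v x = (\<Sum>i. L2_inner l f (X i) * X i x)" for x
  note uc = eigen_series_uniformly_convergent_single[OF h c]
  have sums: "(\<lambda>i. L2_inner l f (X i) * X i x) sums v x" if "x \<in> {0..l}" for x
    unfolding v_def by (rule summable_sums[OF uniformly_convergent_on_sum_summable[OF uc that]])
  have v_cont: "continuous_on {0..l} v"
    unfolding v_def by (rule continuous_on_suminf_uniformly_convergent[OF uc]) (intro continuous_intros X_D)
  have L2: "L2_fun l f" "L2_fun l v" by (intro L2_fun_continuous f v_cont)+
  obtain K where "\<forall>a n x. (\<forall>i. \<bar>lam i * a i\<bar> \<le> h i) \<longrightarrow> x \<in> {0..l} \<longrightarrow> \<bar>\<Sum>i<n. a i * X i x\<bar> \<le> K"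
    using eigen_series_partial_sum_bound[OF h] by (rule exE)
  with c have K: "\<bar>\<Sum>i<n. L2_inner l f (X i) * X i x\<bar> \<le> K" if "x \<in> {0..l}" for n x
    using that by simp
  have "L2_inner l v (X j) = L2_inner l f (X j)" for j
  proof -
    have "(\<lambda>n. LINT x|lebesgue_on {0<..<l}. (\<Sum>i<n. L2_inner l f (X i) * X i x) * X j x)
        \<longlonglongrightarrow> (LINT x|lebesgue_on {0<..<l}. v x * X j x)"
    proof (rule integral_dominated_convergence[where w = "\<lambda>x. K * \<bar>X j x\<bar>"])
      show "(\<lambda>x. v x * X j x) \<in> borel_measurable (lebesgue_on {0<..<l})"
        by (intro borel_measurable_integrable L2_fun_mult_integrable L2 X_L2)
      show "(\<lambda>x. (\<Sum>i<n. L2_inner l f (X i) * X i x) * X j x) \<in> borel_measurable (lebesgue_on {0<..<l})" for n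
        by (intro borel_measurable_integrable L2_fun_mult_integrable L2_fun_sum X_L2 finite_lessThan)
      show "integrable (lebesgue_on {0<..<l}) (\<lambda>x. K * \<bar>X j x\<bar>)"
        by (intro continuous_on_LINT_Ioo continuous_intros X_D)
      show "AE x in lebesgue_on {0<..<l}. (\<lambda>n. (\<Sum>i<n. L2_inner l f (X i) * X i x) * X j x) \<longlonglongrightarrow> v x * X j x"
        using sums by (intro AE_I2 tendsto_mult tendsto_const) (auto simp: sums_def)
      show "AE x in lebesgue_on {0<..<l}. norm ((\<Sum>i<n. L2_inner l f (X i) * X i x) * X j x) \<le> K * \<bar>X j x\<bar>" for n
        using K by (intro AE_I2) (auto simp: abs_mult intro!: mult_right_mono)
    qed
    then have "(\<lambda>n. L2_inner l (X j) (\<lambda>x. \<Sum>i<n. L2_inner l f (X i) * X i x)) \<longlonglongrightarrow> L2_inner l v (X j)"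
      by (simp add: L2_inner_def mult.commute)
    moreover have "L2_inner l (X j) (\<lambda>x. \<Sum>i<n. L2_inner l f (X i) * X i x) = L2_inner l f (X j)" if "n > j" for n
    proof -
      have "L2_inner l (X j) (\<lambda>x. \<Sum>i<n. L2_inner l f (X i) * X i x) = (\<Sum>i<n. if j = i then L2_inner l f (X i) else 0)"
        unfolding L2_inner_sum_right[OF X_L2 X_L2] X_orthonormal by (rule sum.cong) auto
      then show ?thesis using that by (simp add: sum.delta)
    qed
    then have "(\<lambda>n. L2_inner l (X j) (\<lambda>x. \<Sum>i<n. L2_inner l f (X i) * X i x)) \<longlonglongrightarrow> L2_inner l f (X j)"
      by (intro tendsto_eventually eventually_mono[OF eventually_gt_at_top[of j]])
    ultimately show ?thesis by (rule LIMSEQ_unique)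
  qed
  then have "L2_inner l (\<lambda>x. v x - f x) (X j) = 0" for j
    using L2_fun_mult_integrable[OF L2(1) X_L2] L2_fun_mult_integrable[OF L2(2) X_L2]
    by (simp add: L2_inner_def left_diff_distrib)
  moreover have "L2_fun l (\<lambda>x. v x - f x)" by (rule L2_fun_diff[OF L2(2,1)])
  ultimately have "AE x in lebesgue_on {0<..<l}. v x - f x = 0"
    using eigen[unfolded eigen_system_def, THEN conjunct2, THEN conjunct2, THEN conjunct2,
        THEN conjunct2, THEN conjunct2, rule_format, of "\<lambda>x. v x - f x"] by simp
  moreover have "continuous_on {0<..<l} (\<lambda>x. v x - f x)"
    by (intro continuous_on_subset[OF continuous_on_diff[OF v_cont f(1)]]) auto
  ultimately have "v x = f x" if "x \<in> {0<..<l}" for x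
    using continuous_AE_zero[OF _ _ that] by fastforce
  moreover have "v 0 = f 0" "v l = f l" using f X_D(6,7) by (simp_all add: v_def)
  ultimately have "v x = f x" using x by (cases "x = 0 \<or> x = l") auto
  then show ?thesis using sums[OF x] by simp
qed

end

section \<open>The time-fractional diffusion equation\<close>
lemma mittag_leffler_eq: "mittag_leffler \<alpha> z = mittag_leffler2 \<alpha> 1 z"
  by (simp add: mittag_leffler_def mittag_leffler2_def)

lemma mittag_leffler_relaxation_has_derivative:
  assumes "0 < \<alpha>" "\<alpha> \<le> 1" "0 < t"
  shows "((\<lambda>t. mittag_leffler \<alpha> (- \<mu> * t powr \<alpha>)) has_real_derivative
           - (t powr (\<alpha> - 1)) * (\<mu> * mittag_leffler2 \<alpha> \<alpha> (- \<mu> * t powr \<alpha>))) (at t)"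
proof -
  have "((\<lambda>t. - \<mu> * t powr \<alpha>) has_real_derivative - \<mu> * (\<alpha> * t powr (\<alpha> - 1))) (at t)"
    using assms by (auto intro!: derivative_eq_intros)
  from DERIV_chain2[OF mittag_leffler2_1_has_field_derivative[OF assms(1,2)] this]
  show ?thesis using assms by (simp add: mittag_leffler_eq mult_ac)
qed

text \<open>
  The coefficients enter only through their decay: \<open>c\<close> stands for the Fourier coefficients of the initial
  value, \<open>h\<close> for a square summable majorant of \<open>\<lambda>\<^sub>i\<^sup>2 c\<^sub>i\<close>.
\<close>
locale time_fractional_diffusion = sturm_liouville +
  fixes \<alpha> :: real and c h :: "nat \<Rightarrow> real"
  assumes \<alpha>: "0 < \<alpha>" "\<alpha> \<le> 1" and h: "summable (\<lambda>i. (h i)\<^sup>2)"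
    and c: "\<bar>lam i * (lam i * c i)\<bar> \<le> h i"
begin

definition U :: "real \<Rightarrow> real \<Rightarrow> real" where
  "U x t = (\<Sum>i. c i * mittag_leffler \<alpha> (- lam i * t powr \<alpha>) * X i x)"

text \<open>
  The time derivative of \<open>U\<close> with the factor \<open>- t\<^sup>\<alpha>\<^sup>-\<^sup>1\<close> removed.  This factor carries the whole
  singularity at \<open>t = 0\<close>; without it the series converges uniformly down to \<open>t = 0\<close>.
\<close>
definition V :: "real \<Rightarrow> real \<Rightarrow> real" where
  "V x t = (\<Sum>i. lam i * c i * mittag_leffler2 \<alpha> \<alpha> (- lam i * t powr \<alpha>) * X i x)"

lemma relaxation_bounds:
  "\<bar>mittag_leffler \<alpha> (- lam i * t powr \<alpha>)\<bar> \<le> 1"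
  "\<bar>mittag_leffler2 \<alpha> \<alpha> (- lam i * t powr \<alpha>)\<bar> \<le> 1 / Gamma \<alpha>"
  using mittag_leffler2_abs_le[OF \<alpha>, of 1 "lam i * t powr \<alpha>"]
    mittag_leffler2_abs_le[OF \<alpha>, of \<alpha> "lam i * t powr \<alpha>"] lam_pos[of i] \<alpha>
  by (simp_all add: mittag_leffler_eq)

lemma U_coefficient_decay:
  "\<bar>lam i * (lam i * (c i * mittag_leffler \<alpha> (- lam i * t powr \<alpha>)))\<bar> \<le> h i"
proof -
  have "\<bar>lam i * (lam i * (c i * mittag_leffler \<alpha> (- lam i * t powr \<alpha>)))\<bar> =
     \<bar>lam i * (lam i * c i)\<bar> * \<bar>mittag_leffler \<alpha> (- lam i * t powr \<alpha>)\<bar>"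
    by (simp add: abs_mult)
  also have "\<dots> \<le> h i * 1"
    using c[of i] by (intro mult_mono c relaxation_bounds) auto
  finally show ?thesis by simp
qed

lemma V_coefficient_decay:
  "\<bar>lam i * (lam i * c i * mittag_leffler2 \<alpha> \<alpha> (- lam i * t powr \<alpha>))\<bar> \<le> h i * (1 / Gamma \<alpha>)"
proof -
  have "\<bar>lam i * (lam i * c i * mittag_leffler2 \<alpha> \<alpha> (- lam i * t powr \<alpha>))\<bar> =
     \<bar>lam i * (lam i * c i)\<bar> * \<bar>mittag_leffler2 \<alpha> \<alpha> (- lam i * t powr \<alpha>)\<bar>"
    by (simp add: abs_mult)
  also have "\<dots> \<le> h i * (1 / Gamma \<alpha>)"
    using c[of i] by (intro mult_mono c relaxation_bounds) auto
  finally show ?thesis .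
qed

lemma summable_square_scaled: "summable (\<lambda>i. (h i * k)\<^sup>2)"
  using h by (simp add: power_mult_distrib summable_mult2)

lemma U_uniformly_convergent:
  "uniformly_convergent_on ({0..l} \<times> UNIV)
     (\<lambda>n z. \<Sum>i<n. c i * mittag_leffler \<alpha> (- lam i * snd z powr \<alpha>) * X i (fst z))"
  by (rule eigen_series_uniformly_convergent[OF coefficient_decay_weaken[OF h U_coefficient_decay]])

lemma V_uniformly_convergent:
  "uniformly_convergent_on ({0..l} \<times> UNIV)
     (\<lambda>n z. \<Sum>i<n. lam i * c i * mittag_leffler2 \<alpha> \<alpha> (- lam i * snd z powr \<alpha>) * X i (fst z))"
  by (rule eigen_series_uniformly_convergent[OF summable_square_scaled V_coefficient_decay])

lemma U_summable:
  "x \<in> {0..l} \<Longrightarrow> summable (\<lambda>i. c i * mittag_leffler \<alpha> (- lam i * t powr \<alpha>) * X i x)"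
  using uniformly_convergent_on_sum_summable[OF U_uniformly_convergent, of "(x, t)"] by simp

lemma V_sums:
  "x \<in> {0..l} \<Longrightarrow> (\<lambda>i. lam i * c i * mittag_leffler2 \<alpha> \<alpha> (- lam i * t powr \<alpha>) * X i x) sums V x t"
  unfolding V_def
  using uniformly_convergent_on_sum_summable[OF V_uniformly_convergent, of "(x, t)"]
  by (intro summable_sums) simp

lemma U_continuous: "continuous_on ({0..l} \<times> {0..}) (\<lambda>(x, t). U x t)"
proof -
  have "continuous_on ({0..l} \<times> {0..})
     (\<lambda>z. \<Sum>i. c i * mittag_leffler \<alpha> (- lam i * snd z powr \<alpha>) * X i (fst z))"
  proof (rule continuous_on_suminf_uniformly_convergent)
    show "continuous_on ({0..l} \<times> {0..})
        (\<lambda>z. c i * mittag_leffler \<alpha> (- lam i * snd z powr \<alpha>) * X i (fst z))" for i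
      unfolding mittag_leffler_eq using \<alpha>
      by (intro continuous_intros continuous_on_powr' continuous_on_compose2[OF X_D(2)]) auto
  qed (rule uniformly_convergent_on_subset[OF U_uniformly_convergent], auto)
  then show ?thesis by (simp add: U_def case_prod_beta')
qed

lemma V_continuous:
  assumes "x \<in> {0..l}" shows "continuous_on {0..} (V x)"
proof -
  have "continuous_on {0..}
     (\<lambda>t. \<Sum>i. lam i * c i * mittag_leffler2 \<alpha> \<alpha> (- lam i * t powr \<alpha>) * X i x)"
  proof (rule continuous_on_suminf_uniformly_convergent)
    show "continuous_on {0..} (\<lambda>t. lam i * c i * mittag_leffler2 \<alpha> \<alpha> (- lam i * t powr \<alpha>) * X i x)" for i
      using \<alpha> by (intro continuous_intros continuous_on_powr') auto
  qed (rule uniformly_convergent_on_sum_reindex[OF V_uniformly_convergent, where k = "\<lambda>t. (x, t)"],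
      use assms in auto)
  then show ?thesis by (simp add: V_def[abs_def])
qed

text \<open>
  On \<open>s > t / 2\<close> the factor \<open>s\<^sup>\<alpha>\<^sup>-\<^sup>1\<close> is bounded, hence the differentiated series converges uniformly there.
\<close>
lemma U_time_derivative:
  assumes x: "x \<in> {0..l}" and t: "0 < t"
  shows "(U x has_real_derivative - (t powr (\<alpha> - 1)) * V x t) (at t)"
proof -
  let ?S = "{t/2<..}"
  define b where "b i s = - (s powr (\<alpha> - 1)) * (lam i * c i * mittag_leffler2 \<alpha> \<alpha> (- lam i * s powr \<alpha>))" for i s
  have b: "\<bar>lam i * b i s\<bar> \<le> h i * (1 / Gamma \<alpha> * (t/2) powr (\<alpha> - 1))" if "s \<in> ?S" for i s
  proof -
    have "\<bar>lam i * b i s\<bar> = \<bar>lam i * (lam i * c i * mittag_leffler2 \<alpha> \<alpha> (- lam i * s powr \<alpha>))\<bar> * s powr (\<alpha> - 1)"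
      by (simp add: b_def abs_mult)
    also have "\<dots> \<le> h i * (1 / Gamma \<alpha>) * (t/2) powr (\<alpha> - 1)"
      using V_coefficient_decay[of i s] that t \<alpha>
      by (intro mult_mono V_coefficient_decay powr_mono2') auto
    finally show ?thesis by (simp add: mult.assoc)
  qed
  have "((\<lambda>t. \<Sum>i. c i * mittag_leffler \<alpha> (- lam i * t powr \<alpha>) * X i x) has_real_derivative
      (\<Sum>i. b i t * X i x)) (at t)"
  proof (rule has_field_derivative_series'(2)[of ?S])
    fix i s assume "s \<in> ?S"
    then have "0 < s" using t by simp
    have "((\<lambda>t. c i * mittag_leffler \<alpha> (- lam i * t powr \<alpha>) * X i x) has_real_derivative
       c i * (- (s powr (\<alpha> - 1)) * (lam i * mittag_leffler2 \<alpha> \<alpha> (- lam i * s powr \<alpha>))) * X i x) (at s)"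
      by (intro DERIV_cmult_right DERIV_cmult mittag_leffler_relaxation_has_derivative \<alpha> \<open>0 < s\<close>)
    also have "c i * (- (s powr (\<alpha> - 1)) * (lam i * mittag_leffler2 \<alpha> \<alpha> (- lam i * s powr \<alpha>))) * X i x = b i s * X i x"
      by (simp add: b_def)
    finally show "((\<lambda>t. c i * mittag_leffler \<alpha> (- lam i * t powr \<alpha>) * X i x) has_real_derivative b i s * X i x) (at s within ?S)"
      by (rule has_field_derivative_at_within)
  next
    have "uniformly_convergent_on ({0..l} \<times> ?S) (\<lambda>n z. \<Sum>i<n. b i (snd z) * X i (fst z))"
      by (rule eigen_series_uniformly_convergent[OF summable_square_scaled b])
    then show "uniformly_convergent_on ?S (\<lambda>n s. \<Sum>i<n. b i s * X i x)"
      by (rule uniformly_convergent_on_sum_reindex[where k = "\<lambda>s. (x, s)"]) (use x in auto)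
    show "summable (\<lambda>i. c i * mittag_leffler \<alpha> (- lam i * t powr \<alpha>) * X i x)"
      by (rule U_summable[OF x])
  qed (use t in \<open>auto simp: interior_open\<close>)
  also have "(\<Sum>i. b i t * X i x) = - (t powr (\<alpha> - 1)) * V x t"
    using sums_mult[OF V_sums[OF x], of "- (t powr (\<alpha> - 1))" t] by (simp add: b_def sums_iff mult_ac)
  finally show ?thesis by (simp add: U_def[abs_def])
qed

lemma U_C1_in_time:
  assumes "x \<in> {0..l}" shows "U x C1_differentiable_on {0<..<T}"
  unfolding C1_differentiable_on_def
proof (intro exI conjI ballI)
  show "(U x has_vector_derivative - (t powr (\<alpha> - 1)) * V x t) (at t)" if "t \<in> {0<..<T}" for t
    using U_time_derivative[OF assms, of t] that by (simp add: has_real_derivative_iff_has_vector_derivative)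
  show "continuous_on {0<..<T} (\<lambda>t. - (t powr (\<alpha> - 1)) * V x t)"
    by (intro continuous_intros continuous_on_subset[OF V_continuous[OF assms]]) auto
qed

text \<open>
  For \<open>\<alpha> = 1\<close> the Caputo derivative is the ordinary derivative, and \<open>E\<^sub>\<alpha>\<^sub>,\<^sub>\<alpha> = E\<^sub>\<alpha>\<close>.  For \<open>\<alpha> < 1\<close> the derivative of \<open>U\<close>,
  multiplied by the kernel \<open>(t - s)\<^sup>-\<^sup>\<alpha>\<close>, is dominated by a constant times the Beta integrand
  \<open>(t - s)\<^sup>-\<^sup>\<alpha> s\<^sup>\<alpha>\<^sup>-\<^sup>1\<close>, and each term integrates to a multiple of \<open>E\<^sub>\<alpha>(-\<lambda>\<^sub>i t\<^sup>\<alpha>)\<close>.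
\<close>
lemma U_caputo:
  assumes x: "x \<in> {0..l}" and t: "0 < t"
  shows "caputo_exists \<alpha> (U x) t"
    and "caputo \<alpha> (U x) t = - (\<Sum>i. lam i * (c i * mittag_leffler \<alpha> (- lam i * t powr \<alpha>)) * X i x)"
proof -
  have dU: "deriv (U x) s = - (s powr (\<alpha> - 1)) * V x s" if "0 < s" for s
    by (rule DERIV_imp_deriv[OF U_time_derivative[OF x that]])
  have diff: "U x field_differentiable at s" if "0 < s" for s
    using U_time_derivative[OF x that] unfolding field_differentiable_def by blast
  have W: "(\<lambda>i. lam i * (c i * mittag_leffler \<alpha> (- lam i * t powr \<alpha>)) * X i x) sums
      (\<Sum>i. lam i * (c i * mittag_leffler \<alpha> (- lam i * t powr \<alpha>)) * X i x)"
    using uniformly_convergent_on_sum_summable[OF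
        eigen_series_uniformly_convergent_single[OF h U_coefficient_decay] x]
    by (rule summable_sums)
  have "caputo_exists \<alpha> (U x) t \<and>
     caputo \<alpha> (U x) t = - (\<Sum>i. lam i * (c i * mittag_leffler \<alpha> (- lam i * t powr \<alpha>)) * X i x)"
  proof (cases "\<alpha> = 1")
    case True
    have "V x t = (\<Sum>i. lam i * (c i * mittag_leffler \<alpha> (- lam i * t powr \<alpha>)) * X i x)"
      unfolding V_def mittag_leffler_eq using True by (simp add: mult_ac)
    then have "deriv (U x) t = - (\<Sum>i. lam i * (c i * mittag_leffler \<alpha> (- lam i * t powr \<alpha>)) * X i x)"
      using dU[OF t] t True by simp
    then show ?thesis
      using diff True by (simp add: caputo_exists_def caputo_def frac_integral_def)
  next
    case False
    with \<alpha> have a1: "\<alpha> < 1" by simp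
    let ?M = "lebesgue_on {0<..<t}"
    define k where "k s = (t - s) powr (- \<alpha>) * s powr (\<alpha> - 1)" for s
    define e where "e i s = mittag_leffler2 \<alpha> \<alpha> (- lam i * s powr \<alpha>)" for i s
    define s where "s n r = k r * (\<Sum>i<n. lam i * c i * e i r * X i x)" for n r
    have k: "integrable ?M k"
      using Beta_integral_scaled(1)[of "1 - \<alpha>" \<alpha> t] a1 \<alpha> t by (simp add: k_def[abs_def])
    have ke: "integrable ?M (\<lambda>r. k r * e i r)"
      "(LINT r|?M. k r * e i r) = Gamma (1 - \<alpha>) * mittag_leffler \<alpha> (- lam i * t powr \<alpha>)" for i
      using mittag_leffler2_fractional_integral[OF \<alpha> \<alpha>(1) _ t, of "1 - \<alpha>" "- lam i"] a1 t
      by (simp_all add: k_def e_def mult.assoc mittag_leffler_eq)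
    have s_eq: "s n r = (\<Sum>i<n. lam i * c i * X i x * (k r * e i r))" for n r
      by (simp add: s_def sum_distrib_left mult_ac)
    have s_int: "integrable ?M (s n)" for n
      unfolding s_eq[abs_def] by (intro Bochner_Integration.integrable_sum integrable_mult_right ke)
    have s_LINT: "(LINT r|?M. s n r) =
       Gamma (1 - \<alpha>) * (\<Sum>i<n. lam i * (c i * mittag_leffler \<alpha> (- lam i * t powr \<alpha>)) * X i x)" for n
    proof -
      have "(LINT r|?M. s n r) = (\<Sum>i<n. (LINT r|?M. lam i * c i * X i x * (k r * e i r)))"
        unfolding s_eq by (intro Bochner_Integration.integral_sum integrable_mult_right ke)
      also have "\<dots> = (\<Sum>i<n. lam i * c i * X i x * (Gamma (1 - \<alpha>) * mittag_leffler \<alpha> (- lam i * t powr \<alpha>)))"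
        by (simp only: integral_mult_right_zero ke(2))
      finally show ?thesis by (simp add: sum_distrib_left mult_ac)
    qed
    obtain K where Kall: "\<forall>a n x. (\<forall>i. \<bar>lam i * a i\<bar> \<le> h i * (1 / Gamma \<alpha>)) \<longrightarrow> x \<in> {0..l} \<longrightarrow> \<bar>\<Sum>i<n. a i * X i x\<bar> \<le> K"
      using eigen_series_partial_sum_bound[OF summable_square_scaled] by (rule exE)
    have K: "\<bar>\<Sum>i<n. lam i * c i * e i r * X i x\<bar> \<le> K" for n r
      by (rule spec[OF spec[OF spec[OF Kall, of "\<lambda>i. lam i * c i * e i r"], of n], of x, rule_format])
        (use V_coefficient_decay x in \<open>simp_all only: e_def\<close>)
    have lim: "(\<lambda>n. s n r) \<longlonglongrightarrow> k r * V x r" for r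
      unfolding s_def e_def using V_sums[OF x, of r] by (intro tendsto_mult tendsto_const) (simp add: sums_def)
    have meas: "(\<lambda>r. k r * V x r) \<in> borel_measurable ?M"
      by (rule borel_measurable_LIMSEQ_real[OF lim]) (intro borel_measurable_integrable s_int)
    have bound: "AE r in ?M. norm (s n r) \<le> K * \<bar>k r\<bar>" for n
      unfolding s_def using mult_right_mono[OF K, of "\<bar>k _\<bar>"]
      by (intro AE_I2) (simp add: abs_mult mult.commute)
    have w: "integrable ?M (\<lambda>r. K * \<bar>k r\<bar>)" using k by simp
    have AElim: "AE r in ?M. (\<lambda>n. s n r) \<longlonglongrightarrow> k r * V x r" using lim by simp
    note dct = meas borel_measurable_integrable[OF s_int] w AElim bound
    have int: "integrable ?M (\<lambda>r. k r * V x r)"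
      by (rule integrable_dominated_convergence[OF dct])
    have "(\<lambda>n. LINT r|?M. s n r) \<longlonglongrightarrow> (LINT r|?M. k r * V x r)"
      by (rule integral_dominated_convergence[OF dct])
    moreover have "(\<lambda>n. LINT r|?M. s n r) \<longlonglongrightarrow>
       Gamma (1 - \<alpha>) * (\<Sum>i. lam i * (c i * mittag_leffler \<alpha> (- lam i * t powr \<alpha>)) * X i x)"
      unfolding s_LINT using W by (intro tendsto_mult tendsto_const) (simp add: sums_def)
    ultimately have val: "(LINT r|?M. k r * V x r) =
       Gamma (1 - \<alpha>) * (\<Sum>i. lam i * (c i * mittag_leffler \<alpha> (- lam i * t powr \<alpha>)) * X i x)"
      by (rule LIMSEQ_unique)
    have eq: "(t - r) powr (- \<alpha>) * deriv (U x) r = - (k r * V x r)" if "r \<in> {0<..<t}" for r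
      using dU[of r] that by (simp add: k_def)
    have int': "integrable ?M (\<lambda>r. (t - r) powr (- \<alpha>) * deriv (U x) r)"
      by (rule Bochner_Integration.integrable_cong[THEN iffD2, OF refl _ integrable_minus[OF int]]) (simp add: eq)
    then have ex: "set_integrable lebesgue {0<..<t} (\<lambda>r. (t - r) powr (- \<alpha>) * deriv (U x) r)"
      by (simp add: integrable_restrict_space set_integrable_def)
    have "(LINT r:{0<..<t}|lebesgue. (t - r) powr (- \<alpha>) * deriv (U x) r) =
      (LINT r|?M. (t - r) powr (- \<alpha>) * deriv (U x) r)"
      by (simp add: integral_restrict_space set_lebesgue_integral_def)
    also have "\<dots> = (LINT r|?M. - (k r * V x r))"
      by (rule Bochner_Integration.integral_cong[OF refl]) (simp add: eq)
    also have "\<dots> = - (Gamma (1 - \<alpha>) * (\<Sum>i. lam i * (c i * mittag_leffler \<alpha> (- lam i * t powr \<alpha>)) * X i x))"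
      by (simp add: val)
    finally have "caputo \<alpha> (U x) t = - (\<Sum>i. lam i * (c i * mittag_leffler \<alpha> (- lam i * t powr \<alpha>)) * X i x)"
      using a1 less_imp_neq[OF Gamma_real_pos, of "1 - \<alpha>"] by (simp add: caputo_def frac_integral_def)
    then show ?thesis using ex diff by (simp add: caputo_exists_def)
  qed
  then show "caputo_exists \<alpha> (U x) t"
    "caputo \<alpha> (U x) t = - (\<Sum>i. lam i * (c i * mittag_leffler \<alpha> (- lam i * t powr \<alpha>)) * X i x)" by auto
qed

lemma U_space_regularity:
  shows "C2_open 0 l (\<lambda>x. U x t)"
    and "x \<in> {0<..<l} \<Longrightarrow> deriv (\<lambda>y. p y * deriv (\<lambda>z. U z t) y) x - q x * U x t =
        - (\<Sum>i. lam i * (c i * mittag_leffler \<alpha> (- lam i * t powr \<alpha>)) * X i x)"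
  unfolding U_def by (rule eigen_series_classical[OF h U_coefficient_decay], assumption?)+

lemma U_initial: "U x 0 = (\<Sum>i. c i * X i x)"
  using \<alpha> by (simp add: U_def mittag_leffler_eq)

lemma U_boundary: "U 0 t = 0" "U l t = 0"
  by (simp_all add: U_def X_D(6,7))

end

theorem theorem6:
  fixes \<alpha> l T :: real
    and p q u0 :: "real \<Rightarrow> real"
    and lam :: "nat \<Rightarrow> real"
    and X :: "nat \<Rightarrow> real \<Rightarrow> real"
    and u :: "real \<Rightarrow> real \<Rightarrow> real"
  assumes "0 < \<alpha>" and "\<alpha> \<le> 1" and "0 < l" and "0 < T"
    and "C1_closed 0 l p" and "continuous_on {0..l} q"
    and "\<forall>x\<in>{0..l}. 0 < p x" and "\<forall>x\<in>{0..l}. 0 \<le> q x"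
    and "eigen_system p q l lam X"
    and "u0 \<in> M_space p q l" and "L_op_in_M_space p q l u0"
    and "\<forall>x t. u x t =
           (\<Sum>i. L2_inner l u0 (X i) * mittag_leffler \<alpha> (- lam i * t powr \<alpha>) * X i x)"
  shows "(\<forall>x\<in>{0..l}. \<forall>t\<in>{0..T}.
            summable (\<lambda>i. L2_inner l u0 (X i) * mittag_leffler \<alpha> (- lam i * t powr \<alpha>) * X i x)) \<and>
         ibvp_solution \<alpha> p q l T u0 u \<and>
         (\<forall>x\<in>{0..l}. (\<lambda>t. u x t) C1_differentiable_on {0<..<T})"
proof -
  interpret sturm_liouville p q l lam X
    using assms by unfold_locales auto
  obtain h where decay: "summable (\<lambda>i. (h i)\<^sup>2)" "\<And>i. \<bar>lam i * (lam i * L2_inner l u0 (X i))\<bar> \<le> h i"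
    using M_space_coefficients_decay[OF assms(10,11)] by blast
  interpret time_fractional_diffusion p q l lam X \<alpha> "\<lambda>i. L2_inner l u0 (X i)" h
    using assms(1,2) decay by unfold_locales auto
  have u: "u = U" using assms(12) by (intro ext) (simp add: U_def)
  have u0: "continuous_on {0..l} u0" "u0 0 = 0" "u0 l = 0"
    using assms(10) C1_closed_imp_continuous_on by (auto simp: M_space_def)
  have h': "summable (\<lambda>i. (h i / lam 0)\<^sup>2)" "\<bar>lam i * L2_inner l u0 (X i)\<bar> \<le> h i / lam 0" for i
    using coefficient_decay_weaken[OF decay(1), of "\<lambda>i. L2_inner l u0 (X i)"] decay(2) by simp_all
  have init: "U x 0 = u0 x" if "x \<in> {0..l}" for x
    using sums_unique[OF eigen_expansion_sums[OF u0 h' that]] by (simp add: U_initial)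
  have "ibvp_solution \<alpha> p q l T u0 U"
    unfolding ibvp_solution_def
  proof (intro conjI ballI)
    show "continuous_on ({0..l} \<times> {0..T}) (\<lambda>(x, t). U x t)"
      by (rule continuous_on_subset[OF U_continuous]) auto
    show "C2_open 0 l (\<lambda>x. U x t)" for t by (rule U_space_regularity)
    fix x t assume xt: "x \<in> {0<..<l}" "t \<in> {0<..<T}"
    show "caputo_exists \<alpha> (\<lambda>s. U x s) t" by (rule U_caputo) (use xt in auto)
    have "caputo \<alpha> (\<lambda>s. U x s) t =
        - (\<Sum>i. lam i * (L2_inner l u0 (X i) * mittag_leffler \<alpha> (- lam i * t powr \<alpha>)) * X i x)"
      by (rule U_caputo) (use xt in auto)
    then show "caputo \<alpha> (\<lambda>s. U x s) t = deriv (\<lambda>y. p y * deriv (\<lambda>z. U z t) y) x - q x * U x t"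
      using U_space_regularity(2)[OF xt(1), of t] by simp
  qed (use init U_boundary in auto)
  then show ?thesis
    using U_summable U_C1_in_time unfolding u by blast
qed

end
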